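(* Let $X_1,\ldots,X_N$ be i.i.d. random variables with distribution $P$, mean $\mu$ and finite variance $\sigma^2>0$, and let $\widehat\mu_{\mathrm{MOM}}$ be the median of means estimator built from $k\le N/2$ disjoint blocks of cardinality $\lfloor N/k\rfloor$ (see context). For any sequences $l_{k,N}, u_{k,N}$ with $l_{k,N}\gg k\,g^2(N/k)$ and $u_{k,N}\ll k$ as $k,\,N/k\to\infty$, the following bound holds for all $t\in[l_{k,N},u_{k,N}]$: $$\mathbb P\left(\left|\sqrt N(\widehat\mu_{\mathrm{MOM}}-\mu)\right|\ge \sigma\sqrt t\right)\le 2\exp\left(-\frac{t}{\pi}(1+o(1))\right),$$ where $o(1)$ is a function that goes to $0$ as $k,N/k\to\infty$, uniformly over $t\in[l_{k,N},u_{k,N}]$.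
   Context: Median of means estimator: let $G_1,\ldots,G_k\subseteq\{1,\ldots,N\}$ be an arbitrary (possibly random but independent of the data) collection of $k\le N/2$ disjoint subsets (blocks) of cardinality $\lfloor N/k\rfloor$ each, let $\bar X_j=\frac{1}{|G_j|}\sum_{i\in G_j}X_i$, and let $\widehat\mu_{\mathrm{MOM}}=\mathrm{med}(\bar X_1,\ldots,\bar X_k)$, where $\mathrm{med}$ denotes a median, i.e. a minimizer over $z\in\mathbb R$ of $\sum_{j=1}^k|\bar X_j-z|$. The function $g$ is defined for $m>0$ by $$g(m)=\frac{1}{\sqrt m}\,\mathbb E\left[\left(\frac{X_1-\mu}{\sigma}\right)^2\min\left(\left|\frac{X_1-\mu}{\sigma}\right|,\sqrt m\right)\right].$$ Notation: for sequences, $a\ll b$ (equivalently $b\gg a$) means $a/b\to0$. The distribution $P$ is fixed in the limit; the $o(1)$ term may depend on $P$ and on the sequences $l_{k,N},u_{k,N}$. *)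

theory Defs
  imports "HOL-Probability.Probability"
begin

text \<open>
  The limit ``\<open>k, N/k \<rightarrow> \<infinity>\<close>'' over pairs \<open>(k, N)\<close>: a property holds eventually iff it holds
  whenever both \<open>k\<close> and \<open>N/k\<close> exceed some common threshold.
\<close>
definition kN_limit :: "(nat \<times> nat) filter" where
  "kN_limit = inf (filtercomap fst at_top)
                  (filtercomap (\<lambda>(k, N). real N / real k) at_top)"

text \<open>
  \<open>a \<lless> b\<close> means \<open>a / b \<rightarrow> 0\<close>. Eventual positivity of \<open>b\<close> is part of the definition
  because \<open>x / 0 = 0\<close> in HOL, so that otherwise \<open>b = 0\<close> would dominate everything.
\<close>
definition much_less :: "'i filter \<Rightarrow> ('i \<Rightarrow> real) \<Rightarrow> ('i \<Rightarrow> real) \<Rightarrow> bool" where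
  "much_less F a b \<longleftrightarrow> (\<forall>\<^sub>F i in F. 0 < b i) \<and> ((\<lambda>i. a i / b i) \<longlongrightarrow> 0) F"

text \<open>
  The function \<open>g\<close> of a distribution \<open>P\<close> with mean \<open>\<mu>\<close> and standard deviation \<open>\<sigma>\<close>.
\<close>
definition g_fun :: "real measure \<Rightarrow> real \<Rightarrow> real \<Rightarrow> real \<Rightarrow> real" where
  "g_fun P \<mu> \<sigma> m =
     1 / sqrt m * (\<integral>x. ((x - \<mu>) / \<sigma>)\<^sup>2 * min \<bar>(x - \<mu>) / \<sigma>\<bar> (sqrt m) \<partial>P)"

definition iid_sample ::
  "'w measure \<Rightarrow> real measure \<Rightarrow> nat \<Rightarrow> (nat \<Rightarrow> 'w \<Rightarrow> real) \<Rightarrow> bool" where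
  "iid_sample M P N X \<longleftrightarrow>
     prob_space.indep_vars M (\<lambda>_. borel) X {1..N} \<and>
     (\<forall>i\<in>{1..N}. distr M borel (X i) = P)"

definition is_block_family :: "nat \<Rightarrow> nat \<Rightarrow> (nat \<Rightarrow> nat set) \<Rightarrow> bool" where
  "is_block_family k N B \<longleftrightarrow>
     disjoint_family_on B {1..k} \<and> (\<forall>j\<in>{1..k}. B j \<subseteq> {1..N} \<and> card (B j) = N div k)"

text \<open>
  Independence of two random elements that may take values in spaces of different types
  (the library's \<open>indep_var\<close> forces equal types): independence of the generated
  \<open>\<sigma>\<close>-algebras.
\<close>
definition indep_elements ::
  "'w measure \<Rightarrow> 'a measure \<Rightarrow> ('w \<Rightarrow> 'a) \<Rightarrow> 'b measure \<Rightarrow> ('w \<Rightarrow> 'b) \<Rightarrow> bool" where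
  "indep_elements M A U B V \<longleftrightarrow>
     U \<in> M \<rightarrow>\<^sub>M A \<and> V \<in> M \<rightarrow>\<^sub>M B \<and>
     prob_space.indep_set M (sets (vimage_algebra (space M) U A))
                            (sets (vimage_algebra (space M) V B))"

text \<open>
  The blocks may be random. Only \<open>G \<omega> 1, \<dots>, G \<omega> k\<close> matter, hence the restriction;
  the restricted family takes finitely many values, so the discrete \<open>\<sigma>\<close>-algebra is the
  natural one on its range.
\<close>
definition random_blocks ::
  "'w measure \<Rightarrow> nat \<Rightarrow> nat \<Rightarrow> (nat \<Rightarrow> 'w \<Rightarrow> real) \<Rightarrow> ('w \<Rightarrow> nat \<Rightarrow> nat set) \<Rightarrow> bool" where
  "random_blocks M k N X G \<longleftrightarrow>
     (\<forall>\<omega>\<in>space M. is_block_family k N (G \<omega>)) \<and>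
     indep_elements M
       (count_space UNIV) (\<lambda>\<omega>. restrict (G \<omega>) {1..k})
       (PiM {1..N} (\<lambda>_. borel)) (\<lambda>\<omega>. \<lambda>i\<in>{1..N}. X i \<omega>)"

definition block_mean :: "(nat \<Rightarrow> real) \<Rightarrow> nat set \<Rightarrow> real" where
  "block_mean x B = (\<Sum>i\<in>B. x i) / real (card B)"

text \<open>A median need not be unique (when \<open>k\<close> is even), so this is a predicate on \<open>z\<close>.\<close>
definition is_median :: "nat \<Rightarrow> (nat \<Rightarrow> real) \<Rightarrow> real \<Rightarrow> bool" where
  "is_median k a z \<longleftrightarrow> is_arg_min (\<lambda>z. \<Sum>j=1..k. \<bar>a j - z\<bar>) (\<lambda>_. True) z"

definition is_MOM ::
  "'w measure \<Rightarrow> nat \<Rightarrow> (nat \<Rightarrow> 'w \<Rightarrow> real) \<Rightarrow> ('w \<Rightarrow> nat \<Rightarrow> nat set) \<Rightarrow> ('w \<Rightarrow> real) \<Rightarrow> bool" where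
  "is_MOM M k X G \<mu>hat \<longleftrightarrow>
     \<mu>hat \<in> borel_measurable M \<and>
     (\<forall>\<omega>\<in>space M. is_median k (\<lambda>j. block_mean (\<lambda>i. X i \<omega>) (G \<omega> j)) (\<mu>hat \<omega>))"

end

theory Submission
  imports Defs
begin

text \<open>
  If the estimator exceeds \<open>\<mu> + \<sigma> \<surd>(t/N)\<close>, then so do at least half of the \<open>k\<close> independent block
  means. A single block mean does so with probability at most \<open>1 - \<Phi>(s) + 44 g(m)\<close>, where
  \<open>m = \<lfloor>N/k\<rfloor>\<close> and \<open>s\<^sup>2 = t m / N\<close> is about \<open>t / k\<close>. Since \<open>\<Phi>(s) - 1/2\<close> is at least \<open>s\<close> times the
  normal density at \<open>s\<close>, Hoeffding's inequality yields the exponent \<open>- t / \<pi>\<close> up to corrections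
  that vanish because \<open>s \<rightarrow> 0\<close> (from \<open>u \<lless> k\<close>) and \<open>g(m) / s \<rightarrow> 0\<close> (from \<open>k g\<^sup>2(N/k) \<lless> l\<close>).

  The Berry--Esseen bound with \<open>g(m)\<close> in place of a third moment is obtained by Stein's method:
  singling out one summand \<open>\<xi>\<close> of the normalised sum, the error is
  \<open>n E[\<xi>\<^sup>2 min(\<bar>\<xi>\<bar>, 1)]\<close>, and the jump of the indicator is handled by a concentration
  inequality for the sum of the remaining summands.
\<close>

text \<open>Hoeffding's exponent is 2 k times the squared gap of the block probability below 1/2.
  The gap is about s / sqrt(2 pi), and 2 k s^2 / (2 pi) is about t / pi.

  With two moments only, no error may cost more than xi^2 times a bounded factor; hence the
  truncation min(|xi|, 1). The Stein error is made of two expectations of the same modulus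
  \<open>stein_mod\<close>, one unweighted and one weighted by n xi^2. Both weights have mean 1, and
  under both the mean of min(|xi|, 1) is at most \<open>\<gamma>\<close>, so one estimate serves
  twice: 44 = 22 + 22. The jump matters only when S lies within |xi| of z. Since S omits xi, this
  is, given xi, the probability that S falls into a short interval.

  Rounding N/k down has two effects to absorb: g is evaluated at the block size instead of N/k, and
  the blocks cover only k m of the N observations. The o(1) term is read off from a non-asymptotic
  bound, so it depends on P, k, N and t alone and not on the sample space, the blocks or the choice
  of median.\<close>

abbreviation \<Phi> :: "real \<Rightarrow> real" where
  "\<Phi> \<equiv> cdf std_normal_distribution"

interpretation std_normal: real_distribution std_normal_distribution
  by (rule real_dist_normal_dist)

section \<open>The standard normal distribution function and its tails\<close>

lemma cdf_std_normal_has_derivative [derivative_intros]: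
  "(\<Phi> has_real_derivative std_normal_density w) (at w)"
proof -
  have cont: "continuous_on A std_normal_density" for A
    by (auto simp: normal_density_def intro!: continuous_intros)
  \<comment> \<open>The base point \<open>w - 1\<close> makes \<open>w\<close> interior to a compact
    interval, where the fundamental theorem of calculus gives a two-sided derivative.\<close>
  have *: "\<Phi> x = \<Phi> (w - 1) + integral {w - 1..x} std_normal_density" if "w - 1 < x" for x
  proof -
    have "\<Phi> x - \<Phi> (w - 1) = measure std_normal_distribution {w - 1<..x}"
      using that by (rule std_normal.cdf_diff_eq)
    also have "\<dots> = (\<integral>t. indicator {w - 1<..x} t \<partial>std_normal_distribution)"
      by simp
    also have "\<dots> = (LINT t:{w - 1<..x}|lborel. std_normal_density t)"
      by (subst integral_real_density)
         (auto simp: set_lebesgue_integral_def mult.commute normal_density_nonneg)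
    also have "\<dots> = (LINT t:{w - 1..x}|lborel. std_normal_density t)"
      unfolding set_lebesgue_integral_def
      by (intro integral_cong_AE)
         (auto intro!: AE_I[of _ _ "{w - 1}"] simp: indicator_def split: if_splits)
    also have "\<dots> = integral {w - 1..x} std_normal_density"
      by (intro set_borel_integral_eq_integral borel_integrable_compact
                borel_integrable_atLeastAtMost')
         (auto intro: cont)
    finally show ?thesis by simp
  qed
  have "((\<lambda>x. integral {w - 1..x} std_normal_density) has_real_derivative std_normal_density w)
          (at w within {w - 1..w + 1})"
    by (rule integral_has_real_derivative) (auto intro: cont)
  hence "((\<lambda>x. \<Phi> (w - 1) + integral {w - 1..x} std_normal_density) has_real_derivative
          std_normal_density w) (at w)"
    by (subst (asm) at_within_interior) (auto intro!: derivative_eq_intros)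
  moreover have "\<forall>\<^sub>F x in nhds w. \<Phi> x = \<Phi> (w - 1) + integral {w - 1..x} std_normal_density"
    using eventually_nhds_in_open[of "{w - 1<..}" w] * by (auto elim!: eventually_mono)
  ultimately show ?thesis
    by (subst DERIV_cong_ev[OF refl _ refl])
qed

lemma continuous_on_cdf_std_normal [continuous_intros]:
  "continuous_on A f \<Longrightarrow> continuous_on A (\<lambda>x. \<Phi> (f x))"
  by (rule continuous_on_compose2[of UNIV \<Phi>])
     (auto intro!: DERIV_continuous_on cdf_std_normal_has_derivative
           intro: has_field_derivative_at_within)

text \<open>The density is even, so the sum of both values has derivative 0; its limit at infinity
  identifies the constant as 1.\<close>

lemma cdf_std_normal_minus: "\<Phi> (- w) = 1 - \<Phi> w"
proof -
  have "\<exists>c. \<forall>w. \<Phi> w + \<Phi> (- w) = c"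
  proof -
    have "((\<lambda>w. \<Phi> w + \<Phi> (- w)) has_real_derivative 0) (at x)" for x
    proof -
      have "((\<lambda>w. \<Phi> (- w)) has_real_derivative std_normal_density (-x) * (-1)) (at x)"
        by (rule DERIV_chain2[OF cdf_std_normal_has_derivative]) (auto intro!: derivative_eq_intros)
      from DERIV_add[OF cdf_std_normal_has_derivative[of x] this] show ?thesis
        by (simp add: normal_density_def)
    qed
    from DERIV_isconst_all[of "\<lambda>w. \<Phi> w + \<Phi> (- w)"] this show ?thesis by blast
  qed
  then obtain c where c: "\<And>w. \<Phi> w + \<Phi> (- w) = c" by blast
  have "((\<lambda>w. \<Phi> w + \<Phi> (- w)) \<longlongrightarrow> 1 + 0) at_top"
    by (intro tendsto_add std_normal.cdf_lim_at_top_prob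
          filterlim_compose[OF std_normal.cdf_lim_at_bot filterlim_uminus_at_bot_at_top])
  with c have "c = 1"
    by (simp add: tendsto_const_iff)
  with c[of w] show ?thesis by simp
qed

lemma cdf_std_normal_0: "\<Phi> 0 = 1 / 2"
  using cdf_std_normal_minus[of 0] by simp

text \<open>The mean value theorem produces the density at a point of (0, s), and the density
  decreases there. To first order in \<open>s\<close> nothing is lost, which preserves the constant
  1 / sqrt(2 pi) in the final exponent.\<close>

lemma cdf_std_normal_ge:
  assumes "0 \<le> s"
  shows "1 / 2 + s * std_normal_density s \<le> \<Phi> s"
proof (cases "s = 0")
  case False
  with assms have "0 < s" by simp
  then obtain z where z: "0 < z" "z < s" "\<Phi> s - \<Phi> 0 = (s - 0) * std_normal_density z"
    using MVT2[of 0 s \<Phi> std_normal_density] cdf_std_normal_has_derivative by blast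
  have "std_normal_density s \<le> std_normal_density z"
    using z by (auto simp: std_normal_density_def intro!: divide_right_mono)
  hence "s * std_normal_density s \<le> s * std_normal_density z"
    using assms by (rule mult_left_mono)
  moreover have "\<Phi> s = 1 / 2 + s * std_normal_density z"
    using z(3) by (simp add: cdf_std_normal_0)
  ultimately show ?thesis by linarith
qed (simp add: cdf_std_normal_0)

lemma std_normal_density_has_derivative:
  "(std_normal_density has_real_derivative - w * std_normal_density w) (at w)"
  unfolding normal_density_def by (auto intro!: derivative_eq_intros simp: field_simps)

text \<open>The difference \<open>h\<close> (after division by \<open>w\<close>) has a nonpositive
  derivative and tends to 0 at infinity, so it cannot be negative anywhere.\<close>

lemma mills_ratio:
  assumes "0 < w"
  shows "w * (1 - \<Phi> w) \<le> std_normal_density w"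
proof -
  define h where "h = (\<lambda>w. std_normal_density w / w - (1 - \<Phi> w))"
  have tend: "(std_normal_density \<longlongrightarrow> 0) at_top"
    unfolding normal_density_def by real_asymp
  have lim: "(h \<longlongrightarrow> 0) at_top"
  proof -
    have "((\<lambda>w. std_normal_density w * inverse w - (1 - \<Phi> w)) \<longlongrightarrow> 0 * 0 - (1 - 1)) at_top"
      by (intro tendsto_intros tend std_normal.cdf_lim_at_top_prob tendsto_inverse_0_at_top
            filterlim_ident)
    thus ?thesis by (simp add: h_def divide_inverse)
  qed
  have deriv: "(h has_real_derivative - std_normal_density x / x\<^sup>2) (at x)" if "0 < x" for x
    using that unfolding h_def
    by (auto intro!: derivative_eq_intros std_normal_density_has_derivative
             simp: field_simps power2_eq_square)
  have anti: "h y \<le> h x" if "0 < x" "x \<le> y" for x y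
  proof (rule DERIV_nonpos_imp_nonincreasing[OF that(2)])
    fix v assume "x \<le> v"
    with that have "(h has_real_derivative - std_normal_density v / v\<^sup>2) (at v)"
      by (intro deriv) auto
    moreover have "- std_normal_density v / v\<^sup>2 \<le> 0"
      by (simp add: normal_density_nonneg)
    ultimately show "\<exists>y. (h has_real_derivative y) (at v) \<and> y \<le> 0" by blast
  qed
  have "0 \<le> h w"
  proof (rule tendsto_upperbound[OF lim])
    show "\<forall>\<^sub>F x in at_top. h x \<le> h w"
      using eventually_ge_at_top[of w] by eventually_elim (rule anti[OF assms])
  qed simp
  with assms show ?thesis by (simp add: h_def field_simps)
qed

text \<open>Mills' ratio degenerates at 0. On [0, 1] the tail is at most 1/2 and the density is
  bounded below; the constant 5 is generous.\<close>

lemma normal_tail_bound: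
  assumes "0 \<le> w"
  shows "1 - \<Phi> w \<le> 5 * std_normal_density w"
proof (cases "w \<le> 1")
  case True
  have p: "sqrt (2 * pi) \<le> 3"
    using pi_less_4 by (intro real_le_lsqrt) (auto intro: order.trans[OF less_imp_le])
  have "w\<^sup>2 \<le> 1" using assms True by (simp add: abs_square_le_1)
  have "1 - \<Phi> w \<le> 1 / 2"
    using std_normal.cdf_nondecreasing[OF assms] by (simp add: cdf_std_normal_0)
  also have "1 / 2 \<le> 5 * (1 / 3 * exp (- 1 / 2 :: real))"
    using exp_ge_add_one_self[of "-1/2"] by simp
  also have "\<dots> \<le> 5 * std_normal_density w"
    unfolding std_normal_density_def using p \<open>w\<^sup>2 \<le> 1\<close>
    by (intro mult_left_mono mult_mono divide_left_mono) auto
  finally show ?thesis .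
next
  case False
  have "1 * (1 - \<Phi> w) \<le> w * (1 - \<Phi> w)"
    using False std_normal.cdf_bounded_prob by (intro mult_right_mono) auto
  also have "\<dots> \<le> std_normal_density w"
    using False by (intro mills_ratio) auto
  also have "\<dots> \<le> 5 * std_normal_density w"
    by (simp add: normal_density_nonneg)
  finally show ?thesis by simp
qed

section \<open>Stein's equation\<close>

text \<open>The bounded solution \<open>f\<close> of \<open>f' w - w * f w = 1[w < z] - \<Phi> z\<close>, and its derivative off the kink at \<open>z\<close>.\<close>

definition stein_sol :: "real \<Rightarrow> real \<Rightarrow> real" where
  "stein_sol z w = \<Phi> (min w z) * (1 - \<Phi> (max w z)) / std_normal_density w"

definition stein_deriv :: "real \<Rightarrow> real \<Rightarrow> real" where
  "stein_deriv z w = w * stein_sol z w + indicator {..<z} w - \<Phi> z"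

lemma stein_sol_nonneg: "0 \<le> stein_sol z w"
  unfolding stein_sol_def
  by (intro divide_nonneg_nonneg mult_nonneg_nonneg std_normal.cdf_nonneg normal_density_nonneg)
     (simp add: std_normal.cdf_bounded_prob)

text \<open>Bounding either factor of the numerator by 1 and using monotonicity leaves the smaller
  of the two tails at \<open>w\<close>. The resulting bound is uniform in \<open>z\<close>, and the
  tail estimates above apply to it.\<close>

lemma stein_sol_le: "stein_sol z w \<le> (1 - \<Phi> \<bar>w\<bar>) / std_normal_density w"
proof -
  have "\<Phi> (min w z) * (1 - \<Phi> (max w z)) \<le> 1 * (1 - \<Phi> w)"
    by (intro mult_mono) (auto intro: std_normal.cdf_nondecreasing simp: std_normal.cdf_nonneg std_normal.cdf_bounded_prob)
  moreover have "\<Phi> (min w z) * (1 - \<Phi> (max w z)) \<le> \<Phi> w * 1"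
    by (intro mult_mono) (auto intro: std_normal.cdf_nondecreasing simp: std_normal.cdf_nonneg std_normal.cdf_bounded_prob)
  ultimately have "\<Phi> (min w z) * (1 - \<Phi> (max w z)) \<le> 1 - \<Phi> \<bar>w\<bar>"
    using cdf_std_normal_minus[of w] by (auto simp: abs_if)
  thus ?thesis
    unfolding stein_sol_def by (rule divide_right_mono) (rule normal_density_nonneg)
qed

lemma std_normal_density_abs: "std_normal_density \<bar>w\<bar> = std_normal_density w"
  by (simp add: std_normal_density_def)

lemma abs_stein_sol_le: "\<bar>stein_sol z w\<bar> \<le> 5"
proof -
  have "(1 - \<Phi> \<bar>w\<bar>) / std_normal_density w \<le> 5"
    using normal_tail_bound[of "\<bar>w\<bar>"] normal_density_pos[of 1 0 w]
    by (simp add: std_normal_density_abs divide_le_eq)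
  with stein_sol_le[of z w] stein_sol_nonneg[of z w] show ?thesis by linarith
qed

lemma abs_mult_stein_sol_le: "\<bar>w * stein_sol z w\<bar> \<le> 1"
proof (cases "w = 0")
  case False
  have "\<bar>w * stein_sol z w\<bar> = \<bar>w\<bar> * stein_sol z w"
    by (simp add: abs_mult stein_sol_nonneg)
  also have "\<dots> \<le> \<bar>w\<bar> * ((1 - \<Phi> \<bar>w\<bar>) / std_normal_density w)"
    by (intro mult_left_mono stein_sol_le) simp
  also have "\<dots> \<le> 1"
    using mills_ratio[of "\<bar>w\<bar>"] False normal_density_pos[of 1 0 w]
    by (simp add: std_normal_density_abs divide_le_eq)
  finally show ?thesis .
qed simp

lemma abs_stein_deriv_le: "\<bar>stein_deriv z w\<bar> \<le> 2"
  using abs_mult_stein_sol_le[of w z] std_normal.cdf_nonneg[of z] std_normal.cdf_bounded_prob[of z]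
  unfolding stein_deriv_def by (auto simp: indicator_def abs_if split: if_splits)

lemma stein_sol_has_derivative:
  assumes "w \<noteq> z"
  shows "(stein_sol z has_real_derivative stein_deriv z w) (at w)"
proof -
  note pos = normal_density_pos[of 1 0]
  consider "w < z" | "z < w" using assms by linarith
  thus ?thesis
  proof cases
    case 1
    have "((\<lambda>w. \<Phi> w * (1 - \<Phi> z) / std_normal_density w) has_real_derivative stein_deriv z w) (at w)"
      using 1 pos[of w] unfolding stein_deriv_def stein_sol_def
      by (auto intro!: derivative_eq_intros std_normal_density_has_derivative simp: min_def max_def field_simps)
    moreover have "\<forall>\<^sub>F x in nhds w. stein_sol z x = \<Phi> x * (1 - \<Phi> z) / std_normal_density x"
      using eventually_nhds_in_open[of "{..<z}" w] 1
      by (auto elim!: eventually_mono simp: stein_sol_def)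
    ultimately show ?thesis by (subst DERIV_cong_ev[OF refl _ refl])
  next
    case 2
    have "((\<lambda>w. \<Phi> z * (1 - \<Phi> w) / std_normal_density w) has_real_derivative stein_deriv z w) (at w)"
      using 2 pos[of w] unfolding stein_deriv_def stein_sol_def
      by (auto intro!: derivative_eq_intros std_normal_density_has_derivative simp: min_def max_def field_simps)
    moreover have "\<forall>\<^sub>F x in nhds w. stein_sol z x = \<Phi> z * (1 - \<Phi> x) / std_normal_density x"
      using eventually_nhds_in_open[of "{z<..}" w] 2
      by (auto elim!: eventually_mono simp: stein_sol_def)
    ultimately show ?thesis by (subst DERIV_cong_ev[OF refl _ refl])
  qed
qed

lemma continuous_on_stein_sol: "continuous_on A (stein_sol z)"
proof -
  have "std_normal_density w \<noteq> 0" for w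
    using normal_density_pos[of 1 0 w] by simp
  moreover have "continuous_on A std_normal_density"
    by (auto simp: normal_density_def intro!: continuous_intros)
  ultimately show ?thesis
    unfolding stein_sol_def[abs_def] by (auto intro!: continuous_intros)
qed

text \<open>The mean value theorem on either side of the kink at \<open>z\<close>.\<close>

lemma stein_sol_linear_approx:
  assumes "\<And>v. v \<noteq> z \<Longrightarrow> v \<in> closed_segment s (s + x) \<Longrightarrow> \<bar>stein_deriv z v - c\<bar> \<le> B"
  shows "\<bar>stein_sol z (s + x) - stein_sol z s - x * c\<bar> \<le> \<bar>x\<bar> * B"
proof -
  define F where "F = (\<lambda>w. stein_sol z w - w * c)"
  have smooth: "\<bar>F b - F a\<bar> \<le> (b - a) * B"
    if "a \<le> b" and sub: "{a<..<b} \<subseteq> closed_segment s (s + x) - {z}" for a b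
  proof (cases "a = b")
    case False
    with that have "a < b" by simp
    have "\<exists>l. \<exists>v. v > a \<and> v < b \<and> (F has_real_derivative l) (at v) \<and> F b - F a = (b - a) * l"
    proof -
      have "\<exists>l v. a < v \<and> v < b \<and> (F has_real_derivative l) (at v) \<and> F b - F a = (b - a) * l"
      proof (rule MVT[OF \<open>a < b\<close>])
        show "continuous_on {a..b} F"
          unfolding F_def by (intro continuous_intros continuous_on_stein_sol)
        show "F differentiable (at v)" if "a < v" "v < b" for v
        proof -
          have "v \<noteq> z" using sub that by auto
          from stein_sol_has_derivative[OF this]
          have "(F has_real_derivative (stein_deriv z v - c)) (at v)"
            unfolding F_def by (auto intro!: derivative_eq_intros)
          thus ?thesis by (auto simp: real_differentiable_def)
        qed
      qed
      thus ?thesis by blast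
    qed
    then obtain l v where v: "a < v" "v < b" "(F has_real_derivative l) (at v)"
        "F b - F a = (b - a) * l" by blast
    have vz: "v \<noteq> z" "v \<in> closed_segment s (s + x)" using sub v by auto
    have "(F has_real_derivative (stein_deriv z v - c)) (at v)"
      unfolding F_def using stein_sol_has_derivative[OF vz(1)] by (auto intro!: derivative_eq_intros)
    with v have "l = stein_deriv z v - c" using DERIV_unique by blast
    with assms[OF vz] v \<open>a < b\<close> show ?thesis by (simp add: abs_mult mult_left_mono)
  qed simp
  define p q where "p = min s (s + x)" and "q = max s (s + x)"
  have seg: "closed_segment s (s + x) = {p..q}" and "p \<le> q" and "q - p = \<bar>x\<bar>"
    by (auto simp: closed_segment_eq_real_ivl p_def q_def)
  \<comment> \<open>\<open>m\<close> is \<open>z\<close> clamped to the segment, so neither open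
    half contains the kink; if \<open>z\<close> lies outside, one half is degenerate.\<close>
  define m where "m = max p (min q z)"
  have "p \<le> m" "m \<le> q" using \<open>p \<le> q\<close> by (auto simp: m_def)
  have "\<bar>F m - F p\<bar> \<le> (m - p) * B"
    by (rule smooth) (auto simp: seg m_def \<open>p \<le> q\<close> split: if_splits)
  moreover have "\<bar>F q - F m\<bar> \<le> (q - m) * B"
    by (rule smooth) (auto simp: seg m_def \<open>p \<le> q\<close> split: if_splits)
  ultimately have "\<bar>F q - F p\<bar> \<le> (q - p) * B" by (simp add: algebra_simps)
  moreover have "\<bar>F q - F p\<bar> = \<bar>F (s + x) - F s\<bar>"
    by (auto simp: p_def q_def min_def max_def)
  ultimately show ?thesis
    using \<open>q - p = \<bar>x\<bar>\<close> by (simp add: F_def algebra_simps)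
qed

lemma stein_sol_lipschitz: "\<bar>stein_sol z (s + x) - stein_sol z s\<bar> \<le> 2 * \<bar>x\<bar>"
  using stein_sol_linear_approx[of z s x 0 2] abs_stein_deriv_le by simp

text \<open>A modulus of continuity for \<open>stein_deriv z\<close> at \<open>s\<close>. The first
  term controls the continuous part w f(w), the second the jump, which a step of size |x| can cross
  only if |s - z| is at most |x|. It depends on \<open>x\<close> through |x| and increases with it,
  so it bounds the derivative along a whole segment.\<close>

definition stein_mod :: "real \<Rightarrow> real \<Rightarrow> real \<Rightarrow> real" where
  "stein_mod z s x = 5 * (1 + \<bar>s\<bar>) * min \<bar>x\<bar> 1 + 4 * indicator {y. \<bar>s - z\<bar> \<le> \<bar>y\<bar>} x"

lemma stein_mod_mono: "\<bar>x\<bar> \<le> \<bar>y\<bar> \<Longrightarrow> stein_mod z s x \<le> stein_mod z s y"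
  unfolding stein_mod_def by (intro add_mono mult_left_mono) (auto simp: indicator_def)

text \<open>For |x| at most 1, the continuous part changes by x f(s + x) + s (f(s + x) - f(s)),
  where |f| is at most 5 and f has Lipschitz constant 2. For larger |x| the trivial bound 2 + 2 is
  already below the first term of the modulus.\<close>

lemma stein_deriv_diff_le: "\<bar>stein_deriv z (s + x) - stein_deriv z s\<bar> \<le> stein_mod z s x"
proof (cases "\<bar>x\<bar> \<le> 1")
  case True
  have "\<bar>(s + x) * stein_sol z (s + x) - s * stein_sol z s\<bar>
      = \<bar>x * stein_sol z (s + x) + s * (stein_sol z (s + x) - stein_sol z s)\<bar>"
    by (simp add: algebra_simps)
  also have "\<dots> \<le> \<bar>x\<bar> * \<bar>stein_sol z (s + x)\<bar> + \<bar>s\<bar> * \<bar>stein_sol z (s + x) - stein_sol z s\<bar>"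
    by (metis abs_mult abs_triangle_ineq)
  also have "\<dots> \<le> \<bar>x\<bar> * 5 + \<bar>s\<bar> * (2 * \<bar>x\<bar>)"
    by (intro add_mono mult_left_mono abs_stein_sol_le stein_sol_lipschitz) auto
  also have "\<dots> \<le> 5 * (1 + \<bar>s\<bar>) * min \<bar>x\<bar> 1"
    using True mult_nonneg_nonneg[of "\<bar>s\<bar>" "\<bar>x\<bar>"] by (simp add: algebra_simps)
  finally have 1: "\<bar>(s + x) * stein_sol z (s + x) - s * stein_sol z s\<bar> \<le> 5 * (1 + \<bar>s\<bar>) * min \<bar>x\<bar> 1" .
  have 2: "\<bar>indicator {..<z} (s + x) - indicator {..<z} s :: real\<bar>
      \<le> 4 * indicator {y. \<bar>s - z\<bar> \<le> \<bar>y\<bar>} x"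
    by (auto simp: indicator_def)
  show ?thesis
    using 1 2 unfolding stein_deriv_def stein_mod_def by linarith
next
  case False
  have "\<bar>stein_deriv z (s + x) - stein_deriv z s\<bar> \<le> 4"
    using abs_stein_deriv_le[of z s] abs_stein_deriv_le[of z "s + x"] by linarith
  also have "4 \<le> 5 * (1 + \<bar>s\<bar>) * 1" by simp
  also have "\<dots> \<le> stein_mod z s x"
    using False by (simp add: stein_mod_def)
  finally show ?thesis .
qed

lemma stein_sol_taylor:
  "\<bar>stein_sol z (s + x) - stein_sol z s - x * stein_deriv z s\<bar> \<le> \<bar>x\<bar> * stein_mod z s x"
proof (rule stein_sol_linear_approx)
  fix v assume "v \<in> closed_segment s (s + x)"
  hence "\<bar>v - s\<bar> \<le> \<bar>x\<bar>" by (auto simp: closed_segment_eq_real_ivl split: if_splits)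
  with stein_deriv_diff_le[of z s "v - s"] stein_mod_mono[of "v - s" x z s]
  show "\<bar>stein_deriv z v - stein_deriv z s\<bar> \<le> stein_mod z s x" by simp
qed

lemma borel_measurable_stein_sol [measurable]: "stein_sol z \<in> borel_measurable borel"
  by (intro borel_measurable_continuous_onI continuous_on_stein_sol)

lemma borel_measurable_stein_deriv [measurable]: "stein_deriv z \<in> borel_measurable borel"
  unfolding stein_deriv_def[abs_def] by measurable

section \<open>The Berry--Esseen bound\<close>

text \<open>
  \<open>S + \<xi>\<close> models a normalised sum of \<open>n\<close> i.i.d. variables with one summand \<open>\<xi>\<close> singled out;
  exchangeability enters only through the last assumption.
\<close>

locale stein_pair = prob_space +
  fixes S \<xi> :: "'a \<Rightarrow> real" and n :: real
  assumes indep: "indep_var borel S borel \<xi>"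
    and n_pos: "0 < n"
    and sq_integrable_\<xi>: "integrable M (\<lambda>\<omega>. (\<xi> \<omega>)\<^sup>2)"
    and mean_\<xi>: "expectation \<xi> = 0"
    and var_\<xi>: "n * expectation (\<lambda>\<omega>. (\<xi> \<omega>)\<^sup>2) = 1"
    and sq_integrable_S: "integrable M (\<lambda>\<omega>. (S \<omega>)\<^sup>2)"
    and moment_S: "expectation (\<lambda>\<omega>. (S \<omega>)\<^sup>2) \<le> 1"
    and moment_sum: "expectation (\<lambda>\<omega>. (S \<omega> + \<xi> \<omega>)\<^sup>2) \<le> 1"
    and exchange: "\<And>f B. f \<in> borel_measurable borel \<Longrightarrow> (\<And>w. \<bar>f w\<bar> \<le> B) \<Longrightarrow>
      expectation (\<lambda>\<omega>. (S \<omega> + \<xi> \<omega>) * f (S \<omega> + \<xi> \<omega>)) = n * expectation (\<lambda>\<omega>. \<xi> \<omega> * f (S \<omega> + \<xi> \<omega>))"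
begin

lemma measurable_S [measurable]: "S \<in> borel_measurable M"
  and measurable_\<xi> [measurable]: "\<xi> \<in> borel_measurable M"
  using indep by (auto simp: indep_var_eq)

text \<open>The Lindeberg-type truncated third moment. With \<xi> = Y / sqrt n it equals 1 / sqrt n
  times the mean of Y^2 min(|Y|, sqrt n), which is g(n) for standardised Y.\<close>

definition \<gamma> :: real where
  "\<gamma> = n * expectation (\<lambda>\<omega>. (\<xi> \<omega>)\<^sup>2 * min \<bar>\<xi> \<omega>\<bar> 1)"

lemma integrable_sq_bounded:
  fixes X :: "'a \<Rightarrow> real"
  assumes "integrable M (\<lambda>\<omega>. (X \<omega>)\<^sup>2)" "X \<in> borel_measurable M"
  shows "integrable M (\<lambda>\<omega>. \<bar>X \<omega>\<bar>)" "expectation (\<lambda>\<omega>. \<bar>X \<omega>\<bar>) \<le> (1 + expectation (\<lambda>\<omega>. (X \<omega>)\<^sup>2)) / 2"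
proof -
  have le: "\<bar>x\<bar> \<le> (1 + x\<^sup>2) / 2" for x :: real
    using zero_le_power2[of "\<bar>x\<bar> - 1"] by (simp add: power2_diff)
  show *: "integrable M (\<lambda>\<omega>. \<bar>X \<omega>\<bar>)"
    by (rule Bochner_Integration.integrable_bound[of M "\<lambda>\<omega>. (1 + (X \<omega>)\<^sup>2) / 2"])
       (use assms le in auto)
  have "expectation (\<lambda>\<omega>. \<bar>X \<omega>\<bar>) \<le> expectation (\<lambda>\<omega>. (1 + (X \<omega>)\<^sup>2) / 2)"
    using assms * le by (intro integral_mono) auto
  also have "\<dots> = (1 + expectation (\<lambda>\<omega>. (X \<omega>)\<^sup>2)) / 2"
    using assms by (simp add: prob_space)
  finally show "expectation (\<lambda>\<omega>. \<bar>X \<omega>\<bar>) \<le> (1 + expectation (\<lambda>\<omega>. (X \<omega>)\<^sup>2)) / 2" .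
qed

lemmas integrable_abs_S = integrable_sq_bounded(1)[OF sq_integrable_S measurable_S]
lemmas integrable_abs_\<xi> = integrable_sq_bounded(1)[OF sq_integrable_\<xi> measurable_\<xi>]

lemma integrable_\<xi> [simp]: "integrable M \<xi>"
  using integrable_abs_\<xi> by (subst (asm) integrable_abs_iff) auto

lemma integrable_S [simp]: "integrable M S"
  using integrable_abs_S by (subst (asm) integrable_abs_iff) auto

lemma expectation_abs_S: "expectation (\<lambda>\<omega>. \<bar>S \<omega>\<bar>) \<le> 1"
  using integrable_sq_bounded(2)[OF sq_integrable_S measurable_S] moment_S by simp

lemma integrable_mult_bounded:
  fixes h b :: "'a \<Rightarrow> real"
  assumes "integrable M h" "b \<in> borel_measurable M" "\<And>\<omega>. \<bar>b \<omega>\<bar> \<le> B"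
  shows "integrable M (\<lambda>\<omega>. h \<omega> * b \<omega>)"
proof (rule Bochner_Integration.integrable_bound[of M "\<lambda>\<omega>. B * \<bar>h \<omega>\<bar>"])
  have "0 \<le> B" using assms(3) abs_ge_zero order_trans by blast
  show "AE \<omega> in M. norm (h \<omega> * b \<omega>) \<le> norm (B * \<bar>h \<omega>\<bar>)"
  proof (rule AE_I2)
    fix \<omega>
    have "\<bar>h \<omega>\<bar> * \<bar>b \<omega>\<bar> \<le> \<bar>h \<omega>\<bar> * B" by (intro mult_left_mono assms) simp
    with \<open>0 \<le> B\<close> show "norm (h \<omega> * b \<omega>) \<le> norm (B * \<bar>h \<omega>\<bar>)"
      by (simp add: abs_mult mult.commute)
  qed
qed (use assms in auto)

lemma expectation_indep:
  fixes f h :: "real \<Rightarrow> real"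
  assumes [measurable]: "f \<in> borel_measurable borel" "h \<in> borel_measurable borel"
    and "integrable M (\<lambda>\<omega>. f (S \<omega>))" "integrable M (\<lambda>\<omega>. h (\<xi> \<omega>))"
  shows "integrable M (\<lambda>\<omega>. f (S \<omega>) * h (\<xi> \<omega>))"
    and "expectation (\<lambda>\<omega>. f (S \<omega>) * h (\<xi> \<omega>)) = expectation (\<lambda>\<omega>. f (S \<omega>)) * expectation (\<lambda>\<omega>. h (\<xi> \<omega>))"
proof -
  have iv: "indep_var borel (\<lambda>\<omega>. f (S \<omega>)) borel (\<lambda>\<omega>. h (\<xi> \<omega>))"
    using indep_var_compose[OF indep, of f borel h borel] by (simp add: comp_def)
  show "integrable M (\<lambda>\<omega>. f (S \<omega>) * h (\<xi> \<omega>))"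
    using indep_var_integrable[OF iv assms(3,4)] .
  show "expectation (\<lambda>\<omega>. f (S \<omega>) * h (\<xi> \<omega>)) = expectation (\<lambda>\<omega>. f (S \<omega>)) * expectation (\<lambda>\<omega>. h (\<xi> \<omega>))"
    using indep_var_lebesgue_integral[OF iv assms(3,4)] .
qed

lemma integrable_\<gamma>: "integrable M (\<lambda>\<omega>. (\<xi> \<omega>)\<^sup>2 * min \<bar>\<xi> \<omega>\<bar> 1)"
  by (rule integrable_mult_bounded[OF sq_integrable_\<xi>, of _ 1]) auto

text \<open>Positivity allows the window width \<open>\<gamma> / 2\<close> in the concentration
  inequality. If \<open>\<gamma>\<close> were 0, then \<xi> would vanish almost surely, against its
  positive variance.\<close>

lemma \<gamma>_pos: "0 < \<gamma>"
proof -
  have "expectation (\<lambda>\<omega>. (\<xi> \<omega>)\<^sup>2 * min \<bar>\<xi> \<omega>\<bar> 1) \<noteq> 0"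
  proof
    assume "expectation (\<lambda>\<omega>. (\<xi> \<omega>)\<^sup>2 * min \<bar>\<xi> \<omega>\<bar> 1) = 0"
    hence "AE \<omega> in M. (\<xi> \<omega>)\<^sup>2 * min \<bar>\<xi> \<omega>\<bar> 1 = 0"
      using integrable_\<gamma> by (subst (asm) integral_nonneg_eq_0_iff_AE) auto
    hence "AE \<omega> in M. (\<xi> \<omega>)\<^sup>2 = 0" by eventually_elim (auto simp: min_def split: if_splits)
    hence "expectation (\<lambda>\<omega>. (\<xi> \<omega>)\<^sup>2) = 0"
      using sq_integrable_\<xi> by (subst integral_nonneg_eq_0_iff_AE) auto
    with var_\<xi> show False by simp
  qed
  moreover have "0 \<le> expectation (\<lambda>\<omega>. (\<xi> \<omega>)\<^sup>2 * min \<bar>\<xi> \<omega>\<bar> 1)"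
    by (intro Bochner_Integration.integral_nonneg) simp
  ultimately show ?thesis unfolding \<gamma>_def using n_pos by (simp add: zero_less_mult_iff less_le)
qed

text \<open>Chebyshev's association inequality for the increasing functions \<open>\<xi>\<^sup>2\<close> and \<open>min \<bar>\<xi>\<bar> 1\<close> of \<open>\<bar>\<xi>\<bar>\<close>.\<close>

lemma expectation_min_le: "expectation (\<lambda>\<omega>. min \<bar>\<xi> \<omega>\<bar> 1) \<le> \<gamma>"
proof -
  define v where "v = expectation (\<lambda>\<omega>. (\<xi> \<omega>)\<^sup>2)"
  \<comment> \<open>\<open>c\<close> is the value of min(|x|, 1) at |x| = sqrt v, where x^2 = v. The
    factors x^2 - v and min(|x|, 1) - c therefore never have opposite signs.\<close>
  define c where "c = min (sqrt v) 1"
  have "0 \<le> v" unfolding v_def by (intro Bochner_Integration.integral_nonneg) simp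
  have int: "integrable M (\<lambda>\<omega>. min \<bar>\<xi> \<omega>\<bar> 1)"
    by (rule integrable_const_bound[of _ 1]) auto
  have "0 \<le> (x\<^sup>2 - v) * (min \<bar>x\<bar> 1 - c)" for x
  proof (cases "\<bar>x\<bar> \<le> sqrt v")
    case True
    hence "x\<^sup>2 \<le> v" using \<open>0 \<le> v\<close> by (metis abs_le_square_iff real_sqrt_abs real_sqrt_le_iff)
    with True show ?thesis by (intro mult_nonpos_nonpos) (auto simp: c_def)
  next
    case False
    hence "v \<le> x\<^sup>2" using \<open>0 \<le> v\<close> by (metis linorder_le_cases real_sqrt_abs real_sqrt_le_iff)
    with False show ?thesis by (intro mult_nonneg_nonneg) (auto simp: c_def)
  qed
  hence "0 \<le> expectation (\<lambda>\<omega>. ((\<xi> \<omega>)\<^sup>2 - v) * (min \<bar>\<xi> \<omega>\<bar> 1 - c))"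
    by (intro Bochner_Integration.integral_nonneg) simp
  also have "\<dots> = expectation (\<lambda>\<omega>. (\<xi> \<omega>)\<^sup>2 * min \<bar>\<xi> \<omega>\<bar> 1 - c * (\<xi> \<omega>)\<^sup>2 - v * min \<bar>\<xi> \<omega>\<bar> 1 + v * c)"
    by (simp add: algebra_simps)
  also have "\<dots> = expectation (\<lambda>\<omega>. (\<xi> \<omega>)\<^sup>2 * min \<bar>\<xi> \<omega>\<bar> 1) - v * expectation (\<lambda>\<omega>. min \<bar>\<xi> \<omega>\<bar> 1)"
    using integrable_\<gamma> sq_integrable_\<xi> int by (simp add: prob_space v_def)
  finally have "n * (v * expectation (\<lambda>\<omega>. min \<bar>\<xi> \<omega>\<bar> 1)) \<le> \<gamma>"
    unfolding \<gamma>_def using n_pos by (intro mult_left_mono) auto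
  with var_\<xi> show ?thesis by (simp add: v_def flip: mult.assoc)
qed

text \<open>Cutting one factor |\<xi>| off at \<open>d\<close> keeps at least half of the total
  variance 1. The pointwise bound integrates to 1 - \<open>\<gamma>\<close> / (4 d), which is at
  least 1/2 when \<open>\<gamma>\<close> is at most 2 d. In the middle range it is a square (|x| - 2
  d)^2 expanded; for |x| > 1, the bound d \<le> 1/4 makes its left side nonpositive.\<close>

lemma truncated_moment_ge:
  assumes "0 < d" "d \<le> 1 / 4" "\<gamma> \<le> 2 * d"
  shows "1 / 2 \<le> n * expectation (\<lambda>\<omega>. \<bar>\<xi> \<omega>\<bar> * min \<bar>\<xi> \<omega>\<bar> d)"
proof -
  have le: "x\<^sup>2 - x\<^sup>2 * min \<bar>x\<bar> 1 / (4 * d) \<le> \<bar>x\<bar> * min \<bar>x\<bar> d" for x :: real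
  proof -
    consider "\<bar>x\<bar> \<le> d" | "d < \<bar>x\<bar>" "\<bar>x\<bar> \<le> 1" | "1 < \<bar>x\<bar>" by linarith
    thus ?thesis
    proof cases
      case 1
      thus ?thesis using assms by (simp add: power2_eq_square flip: abs_mult)
    next
      case 2
      have "0 \<le> \<bar>x\<bar> * (\<bar>x\<bar> - 2 * d)\<^sup>2" by simp
      also have "\<dots> = 4 * d * (\<bar>x\<bar> * d) + x\<^sup>2 * \<bar>x\<bar> - 4 * d * x\<^sup>2"
        by (simp add: power2_eq_square algebra_simps flip: abs_mult)
      finally show ?thesis using 2 assms by (simp add: field_simps)
    next
      case 3
      have "x\<^sup>2 * (4 * d) \<le> x\<^sup>2 * 1" using assms by (intro mult_left_mono) auto
      hence "x\<^sup>2 - x\<^sup>2 * min \<bar>x\<bar> 1 / (4 * d) \<le> 0" using 3 assms by (simp add: field_simps)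
      also have "0 \<le> \<bar>x\<bar> * min \<bar>x\<bar> d" using assms by simp
      finally show ?thesis .
    qed
  qed
  have "1 / 2 \<le> 1 - \<gamma> / (4 * d)" using assms by (simp add: field_simps)
  also have "\<dots> = n * expectation (\<lambda>\<omega>. (\<xi> \<omega>)\<^sup>2 - (\<xi> \<omega>)\<^sup>2 * min \<bar>\<xi> \<omega>\<bar> 1 / (4 * d))"
    using sq_integrable_\<xi> integrable_\<gamma> var_\<xi> by (simp add: right_diff_distrib \<gamma>_def)
  also have "\<dots> \<le> n * expectation (\<lambda>\<omega>. \<bar>\<xi> \<omega>\<bar> * min \<bar>\<xi> \<omega>\<bar> d)"
    using sq_integrable_\<xi> integrable_\<gamma> n_pos assms
    by (intro mult_left_mono integral_mono le integrable_mult_bounded[OF integrable_abs_\<xi>, of _ d]) auto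
  finally show ?thesis .
qed

text \<open>The test function \<open>f\<close> is the identity centred at \<open>z\<close> and
  clipped at distance r + d. If \<open>S\<close> is within \<open>r\<close> of \<open>z\<close>, a
  step \<xi> moves \<open>f\<close> in its own direction by at least min(|\<xi>|, d). By
  \<open>exchange\<close>, and since E[\<xi> f(S)] = 0, the summed gain n
  E[\<xi> (f(S + \<xi>) - f(S))] equals E[W f(W)] with W = S + \<xi>, which is at most (r + d) E|W|.
  The factor 2 inverts the 1/2 of \<open>truncated_moment_ge\<close>.\<close>

lemma concentration:
  assumes d: "0 < d" "d \<le> 1 / 4" "\<gamma> \<le> 2 * d" and "0 \<le> r"
  shows "prob {\<omega> \<in> space M. \<bar>S \<omega> - z\<bar> \<le> r} \<le> 2 * (r + d)"
proof -
  define f where "f = (\<lambda>w. max (- (r + d)) (min (w - z) (r + d)))"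
  have [measurable]: "f \<in> borel_measurable borel" unfolding f_def by measurable
  have bounded: "\<bar>f w\<bar> \<le> r + d" for w using d \<open>0 \<le> r\<close> by (auto simp: f_def)
  define I where "I = (\<lambda>s::real. indicator {s. \<bar>s - z\<bar> \<le> r} s :: real)"
  have [measurable]: "I \<in> borel_measurable borel" unfolding I_def by measurable
  have pointwise: "I s * (\<bar>x\<bar> * min \<bar>x\<bar> d) \<le> x * f (s + x) - x * f s" for s x
  proof -
    have pos: "I s * min y d \<le> f (s + y) - f s" if "0 \<le> y" for s y
      using that d \<open>0 \<le> r\<close> by (auto simp: I_def f_def indicator_def)
    have neg: "I s * min y d \<le> f s - f (s - y)" if "0 \<le> y" for s y
      using that d \<open>0 \<le> r\<close> by (auto simp: I_def f_def indicator_def)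
    show ?thesis
    proof (cases "0 \<le> x")
      case True
      from mult_left_mono[OF pos[OF this] this] show ?thesis using True by (simp add: algebra_simps)
    next
      case False
      hence "0 \<le> - x" by simp
      from mult_left_mono[OF neg[OF this] this] show ?thesis using False by (simp add: algebra_simps)
    qed
  qed
  have intI: "integrable M (\<lambda>\<omega>. I (S \<omega>))"
    by (rule integrable_const_bound[of _ 1]) (auto simp: I_def indicator_def)
  have intm: "integrable M (\<lambda>\<omega>. \<bar>\<xi> \<omega>\<bar> * min \<bar>\<xi> \<omega>\<bar> d)"
    using d by (intro integrable_mult_bounded[OF integrable_abs_\<xi>, of _ d]) auto
  have intfS: "integrable M (\<lambda>\<omega>. f (S \<omega>))"
    using bounded by (intro integrable_const_bound[of _ "r + d"]) auto
  have int1: "integrable M (\<lambda>\<omega>. \<xi> \<omega> * f (S \<omega> + \<xi> \<omega>))" "integrable M (\<lambda>\<omega>. \<xi> \<omega> * f (S \<omega>))"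
    using bounded by (auto intro!: integrable_mult_bounded[where B = "r + d"])
  have "expectation (\<lambda>\<omega>. f (S \<omega>) * \<xi> \<omega>) = 0"
    by (subst expectation_indep(2)[of f "\<lambda>x. x"]) (auto simp: intfS mean_\<xi>)
  hence zero: "expectation (\<lambda>\<omega>. \<xi> \<omega> * f (S \<omega>)) = 0" by (simp only: mult.commute)
  have intsum: "integrable M (\<lambda>\<omega>. (S \<omega> + \<xi> \<omega>)\<^sup>2)"
  proof -
    have "integrable M (\<lambda>\<omega>. (S \<omega>)\<^sup>2 + (\<xi> \<omega>)\<^sup>2 + 2 * (S \<omega> * \<xi> \<omega>))"
      by (intro Bochner_Integration.integrable_add integrable_mult_right sq_integrable_S sq_integrable_\<xi>
            expectation_indep(1)[of "\<lambda>x. x" "\<lambda>x. x"] integrable_S integrable_\<xi> measurable_ident_sets) simp_all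
    thus ?thesis by (simp only: power2_sum mult.assoc)
  qed
  have abs_sum: "integrable M (\<lambda>\<omega>. \<bar>S \<omega> + \<xi> \<omega>\<bar>)" "expectation (\<lambda>\<omega>. \<bar>S \<omega> + \<xi> \<omega>\<bar>) \<le> 1"
    using integrable_sq_bounded[OF intsum] moment_sum by auto
  have "prob {\<omega> \<in> space M. \<bar>S \<omega> - z\<bar> \<le> r} = expectation (\<lambda>\<omega>. I (S \<omega>))"
  proof -
    have "expectation (\<lambda>\<omega>. I (S \<omega>)) = expectation (indicator {\<omega> \<in> space M. \<bar>S \<omega> - z\<bar> \<le> r})"
      by (intro Bochner_Integration.integral_cong) (auto simp: I_def indicator_def)
    thus ?thesis by simp
  qed
  hence "prob {\<omega> \<in> space M. \<bar>S \<omega> - z\<bar> \<le> r} * (1 / 2)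
      \<le> expectation (\<lambda>\<omega>. I (S \<omega>)) * (n * expectation (\<lambda>\<omega>. \<bar>\<xi> \<omega>\<bar> * min \<bar>\<xi> \<omega>\<bar> d))"
    using truncated_moment_ge[OF d]
    by (intro mult_mono) (auto simp flip: \<open>prob _ = expectation (\<lambda>\<omega>. I (S \<omega>))\<close>)
  also have "\<dots> = n * expectation (\<lambda>\<omega>. I (S \<omega>) * (\<bar>\<xi> \<omega>\<bar> * min \<bar>\<xi> \<omega>\<bar> d))"
    by (subst expectation_indep(2)[of I "\<lambda>x. \<bar>x\<bar> * min \<bar>x\<bar> d"]) (use intI intm in auto)
  also have "\<dots> \<le> n * expectation (\<lambda>\<omega>. \<xi> \<omega> * f (S \<omega> + \<xi> \<omega>) - \<xi> \<omega> * f (S \<omega>))"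
    using n_pos int1 expectation_indep(1)[of I "\<lambda>x. \<bar>x\<bar> * min \<bar>x\<bar> d"] intI intm
    by (intro mult_left_mono integral_mono pointwise) auto
  also have "\<dots> = expectation (\<lambda>\<omega>. (S \<omega> + \<xi> \<omega>) * f (S \<omega> + \<xi> \<omega>))"
    using int1 zero exchange[of f "r + d"] bounded by simp
  also have "\<dots> \<le> expectation (\<lambda>\<omega>. \<bar>S \<omega> + \<xi> \<omega>\<bar> * (r + d))"
  proof (rule integral_mono)
    show "integrable M (\<lambda>\<omega>. (S \<omega> + \<xi> \<omega>) * f (S \<omega> + \<xi> \<omega>))"
      using bounded by (intro integrable_mult_bounded[where B = "r + d"]) auto
    show "(S \<omega> + \<xi> \<omega>) * f (S \<omega> + \<xi> \<omega>) \<le> \<bar>S \<omega> + \<xi> \<omega>\<bar> * (r + d)" for \<omega>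
      using mult_left_mono[OF bounded[of "S \<omega> + \<xi> \<omega>"], of "\<bar>S \<omega> + \<xi> \<omega>\<bar>"]
      by (metis abs_ge_zero abs_le_D1 abs_mult)
  qed (use abs_sum in auto)
  also have "\<dots> = (r + d) * expectation (\<lambda>\<omega>. \<bar>S \<omega> + \<xi> \<omega>\<bar>)" by simp
  also have "\<dots> \<le> (r + d) * 1"
    using abs_sum(2) d \<open>0 \<le> r\<close> by (intro mult_left_mono) auto
  finally show ?thesis by simp
qed

text \<open>Integrate out \<open>S\<close> first: by independence, given \<xi> = y, the indicator
  has mean prob(|S - z| \<le> |y|), which \<open>q\<close> dominates. The argument is Tonelli's
  theorem for the product of the two laws.\<close>

lemma expectation_indicator_le:
  fixes h q :: "real \<Rightarrow> real"
  assumes [measurable]: "h \<in> borel_measurable borel" "q \<in> borel_measurable borel"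
    and nonneg: "\<And>x. 0 \<le> h x"
    and int: "integrable M (\<lambda>\<omega>. h (\<xi> \<omega>))" "integrable M (\<lambda>\<omega>. h (\<xi> \<omega>) * q (\<xi> \<omega>))"
    and q: "\<And>x. prob {\<omega> \<in> space M. \<bar>S \<omega> - z\<bar> \<le> \<bar>x\<bar>} \<le> q x"
  shows "expectation (\<lambda>\<omega>. h (\<xi> \<omega>) * indicator {y. \<bar>S \<omega> - z\<bar> \<le> \<bar>y\<bar>} (\<xi> \<omega>))
       \<le> expectation (\<lambda>\<omega>. h (\<xi> \<omega>) * q (\<xi> \<omega>))"
proof -
  interpret D: prob_space "distr M borel S" by (rule prob_space_distr) simp
  interpret E: prob_space "distr M borel \<xi>" by (rule prob_space_distr) simp
  interpret P: pair_sigma_finite "distr M borel S" "distr M borel \<xi>" ..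
  define A where "A = {p :: real \<times> real. \<bar>fst p - z\<bar> \<le> \<bar>snd p\<bar>}"
  have "Measurable.pred (borel \<Otimes>\<^sub>M borel) (\<lambda>p :: real \<times> real. \<bar>fst p - z\<bar> \<le> \<bar>snd p\<bar>)"
    by measurable
  hence A: "A \<in> sets (borel \<Otimes>\<^sub>M borel)"
    by (simp add: A_def pred_def space_pair_measure)
  have qn: "0 \<le> q x" for x using q[of x] measure_nonneg order_trans by blast
  have eq: "indicator {y. \<bar>S \<omega> - z\<bar> \<le> \<bar>y\<bar>} (\<xi> \<omega>) = (indicator A (S \<omega>, \<xi> \<omega>) :: real)" for \<omega>
    by (auto simp: A_def indicator_def)
  have [measurable]: "(\<lambda>\<omega>. indicator A (S \<omega>, \<xi> \<omega>) :: real) \<in> borel_measurable M"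
    using A by measurable
  have [measurable]: "(\<lambda>\<omega>. of_bool ((S \<omega>, \<xi> \<omega>) \<in> A) :: real) \<in> borel_measurable M"
    by (rule measurable_cong[THEN iffD1, OF _ \<open>(\<lambda>\<omega>. indicator A (S \<omega>, \<xi> \<omega>) :: real) \<in> borel_measurable M\<close>])
       (simp add: indicator_def)
  have int3: "integrable M (\<lambda>\<omega>. h (\<xi> \<omega>) * indicator A (S \<omega>, \<xi> \<omega>))"
    by (rule integrable_mult_bounded[OF int(1), of _ 1]) (auto simp: indicator_def)
  have "ennreal (expectation (\<lambda>\<omega>. h (\<xi> \<omega>) * indicator A (S \<omega>, \<xi> \<omega>)))
      = (\<integral>\<^sup>+\<omega>. ennreal (h (\<xi> \<omega>)) * indicator A (S \<omega>, \<xi> \<omega>) \<partial>M)"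
    by (subst nn_integral_eq_integral[symmetric, OF int3])
       (auto simp: nonneg ennreal_mult intro!: nn_integral_cong split: split_indicator)
  also have "\<dots> = (\<integral>\<^sup>+p. ennreal (h (snd p)) * indicator A p \<partial>distr M (borel \<Otimes>\<^sub>M borel) (\<lambda>\<omega>. (S \<omega>, \<xi> \<omega>)))"
    using A by (subst nn_integral_distr) auto
  also have "\<dots> = (\<integral>\<^sup>+p. ennreal (h (snd p)) * indicator A p \<partial>(distr M borel S \<Otimes>\<^sub>M distr M borel \<xi>))"
    using indep by (simp add: indep_var_distribution_eq)
  also have "\<dots> = (\<integral>\<^sup>+y. \<integral>\<^sup>+x. ennreal (h y) * indicator A (x, y) \<partial>distr M borel S \<partial>distr M borel \<xi>)"
    using A by (subst P.nn_integral_snd[symmetric]) (auto simp: measurable_def[of "borel \<Otimes>\<^sub>M borel"])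
  also have "\<dots> \<le> (\<integral>\<^sup>+y. ennreal (h y * q y) \<partial>distr M borel \<xi>)"
  proof (intro nn_integral_mono)
    fix y :: real
    have "(\<integral>\<^sup>+x. indicator A (x, y) \<partial>distr M borel S)
        = (\<integral>\<^sup>+x. indicator {x. \<bar>x - z\<bar> \<le> \<bar>y\<bar>} x \<partial>distr M borel S)"
      by (auto simp: A_def indicator_def intro!: nn_integral_cong)
    also have "\<dots> = emeasure (distr M borel S) {x. \<bar>x - z\<bar> \<le> \<bar>y\<bar>}"
      by (rule nn_integral_indicator) simp
    also have "\<dots> = prob {\<omega> \<in> space M. \<bar>S \<omega> - z\<bar> \<le> \<bar>y\<bar>}"
      by (subst emeasure_distr) (auto simp: emeasure_eq_measure vimage_def Int_def conj_commute)
    also have "\<dots> \<le> ennreal (q y)" using q by (rule ennreal_leI)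
    finally show "(\<integral>\<^sup>+x. ennreal (h y) * indicator A (x, y) \<partial>distr M borel S) \<le> ennreal (h y * q y)"
      using A by (subst nn_integral_cmult) (auto simp: ennreal_mult nonneg qn intro!: mult_left_mono)
  qed
  also have "\<dots> = (\<integral>\<^sup>+\<omega>. ennreal (h (\<xi> \<omega>) * q (\<xi> \<omega>)) \<partial>M)"
    by (subst nn_integral_distr) auto
  also have "\<dots> = ennreal (expectation (\<lambda>\<omega>. h (\<xi> \<omega>) * q (\<xi> \<omega>)))"
    by (rule nn_integral_eq_integral[OF int(2)]) (simp add: nonneg qn)
  finally show ?thesis
    unfolding eq by (subst (asm) ennreal_le_iff) (auto intro!: Bochner_Integration.integral_nonneg simp: nonneg qn)
qed

text \<open>The weight \<open>h\<close> will be 1 and n x^2. The continuous part contributes 5 (1 +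
  E|S|) \<open>\<gamma>\<close>, at most 10 \<open>\<gamma>\<close>; the jump part contributes 4 (2
  \<open>\<gamma>\<close> + \<open>\<gamma>\<close>) = 12 \<open>\<gamma>\<close>.\<close>

lemma expectation_stein_mod_le:
  fixes h :: "real \<Rightarrow> real"
  assumes [measurable]: "h \<in> borel_measurable borel"
    and nonneg: "\<And>x. 0 \<le> h x"
    and int: "integrable M (\<lambda>\<omega>. h (\<xi> \<omega>))"
    and h1: "expectation (\<lambda>\<omega>. h (\<xi> \<omega>)) = 1"
    and hmin: "expectation (\<lambda>\<omega>. h (\<xi> \<omega>) * min \<bar>\<xi> \<omega>\<bar> 1) \<le> \<gamma>"
    and small: "\<gamma> \<le> 1 / 2"
  shows "integrable M (\<lambda>\<omega>. h (\<xi> \<omega>) * stein_mod z (S \<omega>) (\<xi> \<omega>))"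
    and "expectation (\<lambda>\<omega>. h (\<xi> \<omega>) * stein_mod z (S \<omega>) (\<xi> \<omega>)) \<le> 22 * \<gamma>"
proof -
  define J where "J = (\<lambda>\<omega>. indicator {y. \<bar>S \<omega> - z\<bar> \<le> \<bar>y\<bar>} (\<xi> \<omega>) :: real)"
  have [measurable]: "J \<in> borel_measurable M"
  proof -
    have "J = (\<lambda>\<omega>. if \<bar>S \<omega> - z\<bar> \<le> \<bar>\<xi> \<omega>\<bar> then 1 else 0)" by (auto simp: J_def)
    thus ?thesis by simp
  qed
  have intJ: "integrable M (\<lambda>\<omega>. h (\<xi> \<omega>) * J \<omega>)"
    by (rule integrable_mult_bounded[OF int, of _ 1]) (auto simp: J_def indicator_def)
  have intmin: "integrable M (\<lambda>\<omega>. h (\<xi> \<omega>) * min \<bar>\<xi> \<omega>\<bar> 1)"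
    by (rule integrable_mult_bounded[OF int, of _ 1]) auto
  have intS: "integrable M (\<lambda>\<omega>. 1 + \<bar>S \<omega>\<bar>)" using integrable_abs_S by simp
  note prod = expectation_indep[of "\<lambda>s. 1 + \<bar>s\<bar>" "\<lambda>x. h x * min \<bar>x\<bar> 1"]
  have ints: "integrable M (\<lambda>\<omega>. (1 + \<bar>S \<omega>\<bar>) * (h (\<xi> \<omega>) * min \<bar>\<xi> \<omega>\<bar> 1))"
    by (rule prod(1)) (use intS intmin in auto)
  have eq: "h (\<xi> \<omega>) * stein_mod z (S \<omega>) (\<xi> \<omega>) =
      5 * ((1 + \<bar>S \<omega>\<bar>) * (h (\<xi> \<omega>) * min \<bar>\<xi> \<omega>\<bar> 1)) + 4 * (h (\<xi> \<omega>) * J \<omega>)" for \<omega>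
    by (simp add: stein_mod_def J_def algebra_simps)
  show "integrable M (\<lambda>\<omega>. h (\<xi> \<omega>) * stein_mod z (S \<omega>) (\<xi> \<omega>))"
    unfolding eq using ints intJ by simp
  \<comment> \<open>The window width is d = \<open>\<gamma>\<close> / 2, the smallest that
    \<open>concentration\<close> admits; \<open>small\<close> is exactly d \<le> 1/4.\<close>
  have q: "prob {\<omega> \<in> space M. \<bar>S \<omega> - z\<bar> \<le> \<bar>x\<bar>} \<le> 2 * min \<bar>x\<bar> 1 + \<gamma>" for x
  proof (cases "\<bar>x\<bar> \<le> 1")
    case True
    thus ?thesis using concentration[of "\<gamma> / 2" "\<bar>x\<bar>" z] \<gamma>_pos small by simp
  next
    case False
    have "prob {\<omega> \<in> space M. \<bar>S \<omega> - z\<bar> \<le> \<bar>x\<bar>} \<le> 1" by simp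
    moreover have "min \<bar>x\<bar> 1 = 1" using False by simp
    ultimately show ?thesis using \<gamma>_pos by linarith
  qed
  have mean_hJ: "expectation (\<lambda>\<omega>. h (\<xi> \<omega>) * J \<omega>) \<le> 3 * \<gamma>"
  proof -
    have "expectation (\<lambda>\<omega>. h (\<xi> \<omega>) * J \<omega>) \<le> expectation (\<lambda>\<omega>. h (\<xi> \<omega>) * (2 * min \<bar>\<xi> \<omega>\<bar> 1 + \<gamma>))"
      unfolding J_def using intmin int
      by (intro expectation_indicator_le nonneg q) (auto simp: distrib_left mult.left_commute)
    also have "\<dots> = 2 * expectation (\<lambda>\<omega>. h (\<xi> \<omega>) * min \<bar>\<xi> \<omega>\<bar> 1) + \<gamma>"
      using intmin int h1 by (simp add: distrib_left mult.left_commute)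
    finally show ?thesis using hmin by simp
  qed
  have "expectation (\<lambda>\<omega>. (1 + \<bar>S \<omega>\<bar>) * (h (\<xi> \<omega>) * min \<bar>\<xi> \<omega>\<bar> 1))
      = (1 + expectation (\<lambda>\<omega>. \<bar>S \<omega>\<bar>)) * expectation (\<lambda>\<omega>. h (\<xi> \<omega>) * min \<bar>\<xi> \<omega>\<bar> 1)"
    using intS intmin integrable_abs_S by (subst prod(2)) (auto simp: prob_space)
  also have "\<dots> \<le> 2 * \<gamma>"
    using expectation_abs_S hmin by (intro mult_mono) (auto intro!: Bochner_Integration.integral_nonneg simp: nonneg)
  finally show "expectation (\<lambda>\<omega>. h (\<xi> \<omega>) * stein_mod z (S \<omega>) (\<xi> \<omega>)) \<le> 22 * \<gamma>"
    unfolding eq using ints intJ mean_hJ by simp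
qed

text \<open>Write W = S + \<xi>, let f be the Stein solution and g its derivative. The error is
  E[g(W)] - E[W f(W)], and \<open>exchange\<close> rewrites the second mean as n E[\<xi> f(W)].
  Expanding f(W) about S leaves E[g(W) - g(S)] minus n times the remainder \<open>R\<close>. Each
  part is a weighted mean of \<open>stein_mod\<close>. For \<open>\<gamma>\<close> > 1/2 the claim
  is trivial.\<close>

theorem berry_esseen: "\<bar>prob {\<omega> \<in> space M. S \<omega> + \<xi> \<omega> < z} - \<Phi> z\<bar> \<le> 44 * \<gamma>"
proof (cases "\<gamma> \<le> 1 / 2")
  case False
  have "\<bar>prob {\<omega> \<in> space M. S \<omega> + \<xi> \<omega> < z} - \<Phi> z\<bar> \<le> 1"
    using prob_le_1[of "{\<omega> \<in> space M. S \<omega> + \<xi> \<omega> < z}"] std_normal.cdf_nonneg[of z] std_normal.cdf_bounded_prob[of z]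
    measure_nonneg[of M "{\<omega> \<in> space M. S \<omega> + \<xi> \<omega> < z}"]
    by linarith
  with False show ?thesis by linarith
next
  case True
  define W where "W = (\<lambda>\<omega>. S \<omega> + \<xi> \<omega>)"
  have [measurable]: "W \<in> borel_measurable M" unfolding W_def by measurable
  define f g where "f = stein_sol z" and "g = stein_deriv z"
  have [measurable]: "f \<in> borel_measurable borel" "g \<in> borel_measurable borel"
    unfolding f_def g_def by simp_all
  have fb: "\<bar>f w\<bar> \<le> 5" and gb: "\<bar>g w\<bar> \<le> 2" for w
    unfolding f_def g_def by (rule abs_stein_sol_le abs_stein_deriv_le)+
  have intg: "integrable M (\<lambda>\<omega>. g (X \<omega>))" if "X \<in> borel_measurable M" for X
    using gb that by (intro integrable_const_bound[of _ 2]) auto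
  have intf: "integrable M (\<lambda>\<omega>. f (X \<omega>))" if "X \<in> borel_measurable M" for X
    using fb that by (intro integrable_const_bound[of _ 5]) auto
  have intW: "integrable M W" unfolding W_def by simp
  have intWf: "integrable M (\<lambda>\<omega>. W \<omega> * f (W \<omega>))"
    using fb by (intro integrable_mult_bounded[OF intW, of _ 5]) auto
  have int\<xi>f: "integrable M (\<lambda>\<omega>. \<xi> \<omega> * f (W \<omega>))" "integrable M (\<lambda>\<omega>. \<xi> \<omega> * f (S \<omega>))"
    using fb by (auto intro!: integrable_mult_bounded[where B = 5])
  have int\<xi>g: "integrable M (\<lambda>\<omega>. (\<xi> \<omega>)\<^sup>2 * g (S \<omega>))"
    using gb by (intro integrable_mult_bounded[OF sq_integrable_\<xi>, of _ 2]) auto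

  \<comment> \<open>\<open>stein_deriv\<close> is defined through Stein's equation at every point,
    the kink included, so the identity is pointwise and no null set has to be discarded.\<close>
  have "expectation (\<lambda>\<omega>. g (W \<omega>)) =
      expectation (\<lambda>\<omega>. W \<omega> * f (W \<omega>) + indicator {\<omega> \<in> space M. W \<omega> < z} \<omega> - \<Phi> z)"
    by (intro Bochner_Integration.integral_cong)
       (auto simp: g_def f_def stein_deriv_def indicator_def)
  also have "\<dots> = expectation (\<lambda>\<omega>. W \<omega> * f (W \<omega>)) + prob {\<omega> \<in> space M. W \<omega> < z} - \<Phi> z"
  proof -
    have "integrable M (indicat_real {\<omega> \<in> space M. W \<omega> < z})"
      by (rule integrable_const_bound[of _ 1]) (auto simp: indicator_def)
    thus ?thesis using intWf by (simp add: prob_space)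
  qed
  finally have 1: "prob {\<omega> \<in> space M. W \<omega> < z} - \<Phi> z =
      expectation (\<lambda>\<omega>. g (W \<omega>)) - n * expectation (\<lambda>\<omega>. \<xi> \<omega> * f (W \<omega>))"
    using exchange[of f 5] fb by (simp add: W_def)

  \<comment> \<open>\<xi> times the first-order Taylor remainder. By independence the order-zero
    term has mean 0, and n times the first-order term has mean E[g(S)], because n E[\<xi>^2] =
    1.\<close>
  define R where "R = (\<lambda>\<omega>. \<xi> \<omega> * (f (W \<omega>) - f (S \<omega>) - \<xi> \<omega> * g (S \<omega>)))"
  have R_eq: "R \<omega> = \<xi> \<omega> * f (W \<omega>) - \<xi> \<omega> * f (S \<omega>) - (\<xi> \<omega>)\<^sup>2 * g (S \<omega>)" for \<omega>
    by (simp add: R_def algebra_simps power2_eq_square)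
  have "expectation (\<lambda>\<omega>. f (S \<omega>) * \<xi> \<omega>) = 0"
    by (subst expectation_indep(2)[of f "\<lambda>x. x"]) (auto simp: intf mean_\<xi>)
  hence "expectation (\<lambda>\<omega>. \<xi> \<omega> * f (S \<omega>)) = 0" by (simp only: mult.commute)
  moreover have "n * expectation (\<lambda>\<omega>. (\<xi> \<omega>)\<^sup>2 * g (S \<omega>)) = expectation (\<lambda>\<omega>. g (S \<omega>))"
  proof -
    have "n * expectation (\<lambda>\<omega>. (\<xi> \<omega>)\<^sup>2 * g (S \<omega>)) = n * expectation (\<lambda>\<omega>. g (S \<omega>) * (\<xi> \<omega>)\<^sup>2)"
      by (simp only: mult.commute)
    also have "\<dots> = n * (expectation (\<lambda>\<omega>. g (S \<omega>)) * expectation (\<lambda>\<omega>. (\<xi> \<omega>)\<^sup>2))"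
      using expectation_indep(2)[of g "\<lambda>x. x\<^sup>2"] intg sq_integrable_\<xi> by simp
    also have "\<dots> = expectation (\<lambda>\<omega>. g (S \<omega>)) * (n * expectation (\<lambda>\<omega>. (\<xi> \<omega>)\<^sup>2))"
      by (simp only: mult.left_commute)
    finally show ?thesis unfolding var_\<xi> by simp
  qed
  moreover have "expectation (\<lambda>\<omega>. R \<omega>) = expectation (\<lambda>\<omega>. \<xi> \<omega> * f (W \<omega>))
      - expectation (\<lambda>\<omega>. \<xi> \<omega> * f (S \<omega>)) - expectation (\<lambda>\<omega>. (\<xi> \<omega>)\<^sup>2 * g (S \<omega>))"
    unfolding R_eq using int\<xi>f int\<xi>g by simp
  ultimately have 2: "n * expectation (\<lambda>\<omega>. \<xi> \<omega> * f (W \<omega>)) = n * expectation R + expectation (\<lambda>\<omega>. g (S \<omega>))"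
    by (simp add: right_diff_distrib)

  have mod1: "integrable M (\<lambda>\<omega>. stein_mod z (S \<omega>) (\<xi> \<omega>))"
      "expectation (\<lambda>\<omega>. stein_mod z (S \<omega>) (\<xi> \<omega>)) \<le> 22 * \<gamma>"
    by (rule expectation_stein_mod_le[of "\<lambda>x. 1" z, unfolded mult_1_left, OF _ _ _ _ expectation_min_le True];
        simp add: prob_space)+
  note mod2 = expectation_stein_mod_le[of "\<lambda>x. n * x\<^sup>2" z]
  have 3: "\<bar>expectation (\<lambda>\<omega>. g (W \<omega>)) - expectation (\<lambda>\<omega>. g (S \<omega>))\<bar> \<le> 22 * \<gamma>"
  proof -
    have "\<bar>expectation (\<lambda>\<omega>. g (W \<omega>)) - expectation (\<lambda>\<omega>. g (S \<omega>))\<bar> = \<bar>expectation (\<lambda>\<omega>. g (W \<omega>) - g (S \<omega>))\<bar>"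
      using intg by simp
    also have "\<dots> \<le> expectation (\<lambda>\<omega>. \<bar>g (W \<omega>) - g (S \<omega>)\<bar>)"
      by (rule integral_abs_bound)
    also have "\<dots> \<le> expectation (\<lambda>\<omega>. stein_mod z (S \<omega>) (\<xi> \<omega>))"
    proof (rule integral_mono)
      show "integrable M (\<lambda>\<omega>. \<bar>g (W \<omega>) - g (S \<omega>)\<bar>)"
        by (intro integrable_abs Bochner_Integration.integrable_diff intg) measurable
      show "\<bar>g (W \<omega>) - g (S \<omega>)\<bar> \<le> stein_mod z (S \<omega>) (\<xi> \<omega>)" for \<omega>
        unfolding g_def W_def by (rule stein_deriv_diff_le)
    qed (rule mod1)
    also note mod1(2)
    finally show ?thesis .
  qed
  have 4: "\<bar>n * expectation R\<bar> \<le> 22 * \<gamma>"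
  proof -
    have intR: "integrable M (\<lambda>\<omega>. R \<omega>)" unfolding R_eq using int\<xi>f int\<xi>g by simp
    have nint: "integrable M (\<lambda>\<omega>. n * (\<xi> \<omega>)\<^sup>2)" using sq_integrable_\<xi> by simp
    have nexp: "expectation (\<lambda>\<omega>. n * (\<xi> \<omega>)\<^sup>2) = 1" using var_\<xi> by simp
    have n\<gamma>: "expectation (\<lambda>\<omega>. n * (\<xi> \<omega>)\<^sup>2 * min \<bar>\<xi> \<omega>\<bar> 1) \<le> \<gamma>"
      by (simp add: \<gamma>_def mult.assoc)
    have mod: "integrable M (\<lambda>\<omega>. n * (\<xi> \<omega>)\<^sup>2 * stein_mod z (S \<omega>) (\<xi> \<omega>))"
      "expectation (\<lambda>\<omega>. n * (\<xi> \<omega>)\<^sup>2 * stein_mod z (S \<omega>) (\<xi> \<omega>)) \<le> 22 * \<gamma>"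
      using n_pos by (auto intro!: mod2 nint nexp n\<gamma> True)
    have "\<bar>n * expectation R\<bar> = \<bar>expectation (\<lambda>\<omega>. n * R \<omega>)\<bar>" by simp
    also have "\<dots> \<le> expectation (\<lambda>\<omega>. \<bar>n * R \<omega>\<bar>)" by (rule integral_abs_bound)
    also have "\<dots> \<le> expectation (\<lambda>\<omega>. n * (\<xi> \<omega>)\<^sup>2 * stein_mod z (S \<omega>) (\<xi> \<omega>))"
    proof (rule integral_mono)
      show "\<bar>n * R \<omega>\<bar> \<le> n * (\<xi> \<omega>)\<^sup>2 * stein_mod z (S \<omega>) (\<xi> \<omega>)" for \<omega>
      proof -
        have "\<bar>n * R \<omega>\<bar> = n * (\<bar>\<xi> \<omega>\<bar> * \<bar>f (W \<omega>) - f (S \<omega>) - \<xi> \<omega> * g (S \<omega>)\<bar>)"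
          using n_pos by (simp add: R_def abs_mult)
        also have "\<dots> \<le> n * (\<bar>\<xi> \<omega>\<bar> * (\<bar>\<xi> \<omega>\<bar> * stein_mod z (S \<omega>) (\<xi> \<omega>)))"
          unfolding f_def g_def W_def using n_pos by (intro mult_left_mono stein_sol_taylor) auto
        finally show ?thesis by (simp add: power2_eq_square mult.assoc flip: abs_mult)
      qed
    qed (use intR mod in auto)
    also note mod(2)
    finally show ?thesis .
  qed
  from 1 2 3 4 show ?thesis by (simp add: W_def)
qed

end

section \<open>From one singled-out summand to i.i.d. sums\<close>

context prob_space
begin

lemma indep_var_swap:
  assumes "indep_var N X N' Y"
  shows "indep_var N' Y N X"
proof -
  have "indep_set B A" if "indep_set A B" for A B
    unfolding indep_sets2_eq
  proof (intro conjI ballI)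
    fix b a assume "b \<in> B" "a \<in> A"
    with indep_setD[OF that, of a b] show "prob (b \<inter> a) = prob b * prob a"
      by (simp add: Int_commute mult.commute)
  qed (use that in \<open>auto simp: indep_sets2_eq\<close>)
  with assms show ?thesis unfolding indep_var_eq by blast
qed

text \<open>Both characteristic functions are the same power of that of \<open>Q\<close>. It is
  applied to leave-one-out sums, which therefore share one law whichever summand is omitted.\<close>

lemma distr_sum_iid_eq:
  fixes Z :: "'i \<Rightarrow> 'a \<Rightarrow> real"
  assumes J: "indep_vars (\<lambda>_. borel) Z J" and K: "indep_vars (\<lambda>_. borel) Z K"
    and iid: "\<And>i. i \<in> J \<union> K \<Longrightarrow> distr M borel (Z i) = Q" and card: "card J = card K"
  shows "distr M borel (\<lambda>\<omega>. \<Sum>i\<in>J. Z i \<omega>) = distr M borel (\<lambda>\<omega>. \<Sum>i\<in>K. Z i \<omega>)"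
proof (rule Levy_uniqueness)
  have rv: "random_variable borel (Z i)" if "i \<in> J \<union> K" for i
    using that J K by (auto simp: indep_vars_def)
  show "real_distribution (distr M borel (\<lambda>\<omega>. \<Sum>i\<in>J. Z i \<omega>))"
    by (intro real_distribution_distr borel_measurable_sum rv) simp
  show "real_distribution (distr M borel (\<lambda>\<omega>. \<Sum>i\<in>K. Z i \<omega>))"
    by (intro real_distribution_distr borel_measurable_sum rv) simp
  show "char (distr M borel (\<lambda>\<omega>. \<Sum>i\<in>J. Z i \<omega>)) = char (distr M borel (\<lambda>\<omega>. \<Sum>i\<in>K. Z i \<omega>))"
    using iid card by (auto simp: char_distr_sum[OF J] char_distr_sum[OF K])
qed

lemma expectation_sum_squares:
  fixes Z :: "'i \<Rightarrow> 'a \<Rightarrow> real"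
  assumes "finite J" "indep_vars (\<lambda>_. borel) Z J"
    and "\<And>i. i \<in> J \<Longrightarrow> integrable M (Z i)" "\<And>i. i \<in> J \<Longrightarrow> integrable M (\<lambda>\<omega>. (Z i \<omega>)\<^sup>2)"
    and "\<And>i. i \<in> J \<Longrightarrow> expectation (Z i) = 0" "\<And>i. i \<in> J \<Longrightarrow> expectation (\<lambda>\<omega>. (Z i \<omega>)\<^sup>2) = v"
  shows "integrable M (\<lambda>\<omega>. (\<Sum>i\<in>J. Z i \<omega>)\<^sup>2) \<and> expectation (\<lambda>\<omega>. (\<Sum>i\<in>J. Z i \<omega>)\<^sup>2) = real (card J) * v"
  using assms
proof (induction J rule: finite_induct)
  case (insert j J)
  define T where "T = (\<lambda>\<omega>. \<Sum>i\<in>J. Z i \<omega>)"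
  have iv: "indep_var borel (Z j) borel T"
    unfolding T_def using insert by (intro indep_vars_sum) auto
  have intT: "integrable M T" unfolding T_def using insert by (intro Bochner_Integration.integrable_sum) auto
  have intj: "integrable M (Z j)" using insert by auto
  have IH: "integrable M (\<lambda>\<omega>. (T \<omega>)\<^sup>2)" "expectation (\<lambda>\<omega>. (T \<omega>)\<^sup>2) = real (card J) * v"
    using insert.IH insert.prems indep_vars_subset[of "\<lambda>_. borel" Z "insert j J" J]
    by (auto simp: T_def)
  have eq: "(\<Sum>i\<in>insert j J. Z i \<omega>)\<^sup>2 = (Z j \<omega>)\<^sup>2 + (T \<omega>)\<^sup>2 + 2 * (Z j \<omega> * T \<omega>)" for \<omega>
    using insert.hyps by (simp add: T_def power2_sum)
  have "integrable M (\<lambda>\<omega>. Z j \<omega> * T \<omega>)" "expectation (\<lambda>\<omega>. Z j \<omega> * T \<omega>) = 0"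
    using indep_var_integrable[OF iv intj intT] indep_var_lebesgue_integral[OF iv intj intT] insert.prems(4)[of j]
    by auto
  with IH insert.prems(3,5)[of j] insert.hyps show ?case
    unfolding eq by (auto simp: distrib_right)
qed simp

lemma expectation_pair_eq:
  fixes U U' :: "'a \<Rightarrow> real" and V V' :: "'a \<Rightarrow> real"
  assumes "indep_var borel U borel V" "indep_var borel U' borel V'"
    and "distr M borel U = distr M borel U'" "distr M borel V = distr M borel V'"
    and [measurable]: "f \<in> borel_measurable (borel \<Otimes>\<^sub>M borel)"
  shows "expectation (\<lambda>\<omega>. f (U \<omega>, V \<omega>)) = (expectation (\<lambda>\<omega>. f (U' \<omega>, V' \<omega>)) :: real)"
proof -
  have [measurable]: "random_variable borel U" "random_variable borel V"
      "random_variable borel U'" "random_variable borel V'"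
    using assms indep_var_rv1 indep_var_rv2 by blast+
  have "expectation (\<lambda>\<omega>. f (U \<omega>, V \<omega>)) = integral\<^sup>L (distr M (borel \<Otimes>\<^sub>M borel) (\<lambda>\<omega>. (U \<omega>, V \<omega>))) f"
    by (subst integral_distr) auto
  also have "distr M (borel \<Otimes>\<^sub>M borel) (\<lambda>\<omega>. (U \<omega>, V \<omega>)) = distr M (borel \<Otimes>\<^sub>M borel) (\<lambda>\<omega>. (U' \<omega>, V' \<omega>))"
    using assms by (simp add: indep_var_distribution_eq)
  also have "integral\<^sup>L \<dots> f = expectation (\<lambda>\<omega>. f (U' \<omega>, V' \<omega>))"
    by (subst integral_distr) auto
  finally show ?thesis .
qed

text \<open>An instance of \<open>stein_pair\<close> for the scaled variables \<open>Z\<close>, with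
  an arbitrary \<open>i0\<close> singled out and \<open>S i0\<close> the sum of the others (0 if
  there are none). It remains to verify \<open>exchange\<close> and to rescale \<gamma>.\<close>

theorem berry_esseen_iid:
  fixes Y :: "'i \<Rightarrow> 'a \<Rightarrow> real"
  assumes I: "finite I" "I \<noteq> {}" and indep: "indep_vars (\<lambda>_. borel) Y I"
    and iid: "\<And>i. i \<in> I \<Longrightarrow> distr M borel (Y i) = Q"
    and Q: "integrable Q (\<lambda>x. x)" "(\<integral>x. x \<partial>Q) = 0" "integrable Q (\<lambda>x. x\<^sup>2)" "(\<integral>x. x\<^sup>2 \<partial>Q) = 1"
  shows "\<bar>prob {\<omega> \<in> space M. (\<Sum>i\<in>I. Y i \<omega>) / sqrt (card I) < z} - \<Phi> z\<bar>
       \<le> 44 * (1 / sqrt (card I) * (\<integral>x. x\<^sup>2 * min \<bar>x\<bar> (sqrt (card I)) \<partial>Q))"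
proof -
  define m where "m = real (card I)"
  have m: "0 < m" using I by (simp add: m_def card_gt_0_iff)
  define Z where "Z = (\<lambda>i \<omega>. Y i \<omega> / sqrt m)"
  have rvY [measurable]: "random_variable borel (Y i)" if "i \<in> I" for i
    using indep that by (auto simp: indep_vars_def)
  have rvZ [measurable]: "random_variable borel (Z i)" if "i \<in> I" for i
    using that unfolding Z_def by simp
  have indepZ: "indep_vars (\<lambda>_. borel) Z I"
    unfolding Z_def by (rule indep_vars_compose2[OF indep]) simp
  have transfer: "expectation (\<lambda>\<omega>. h (Y i \<omega>)) = integral\<^sup>L Q h" "integrable M (\<lambda>\<omega>. h (Y i \<omega>)) = integrable Q h"
    if "i \<in> I" "h \<in> borel_measurable borel" for i and h :: "real \<Rightarrow> real"
    unfolding iid[OF that(1), symmetric] using rvY[OF that(1)] that(2)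
    by (simp_all only: integral_distr integrable_distr_eq)
  have Z1: "integrable M (Z i)" "expectation (Z i) = 0" if "i \<in> I" for i
  proof -
    have id: "(\<lambda>x::real. x) \<in> borel_measurable borel" by simp
    have "integrable M (Y i)" "expectation (Y i) = 0"
      using Q(1,2) by (simp_all only: transfer[OF that id])
    thus "integrable M (Z i)" "expectation (Z i) = 0" unfolding Z_def by simp_all
  qed
  have Z2: "integrable M (\<lambda>\<omega>. (Z i \<omega>)\<^sup>2)" "expectation (\<lambda>\<omega>. (Z i \<omega>)\<^sup>2) = 1 / m" if "i \<in> I" for i
  proof -
    have sq: "(\<lambda>x::real. x\<^sup>2) \<in> borel_measurable borel" by measurable
    have "integrable M (\<lambda>\<omega>. (Y i \<omega>)\<^sup>2)" "expectation (\<lambda>\<omega>. (Y i \<omega>)\<^sup>2) = 1"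
      using Q(3,4) by (simp_all only: transfer[OF that sq])
    thus "integrable M (\<lambda>\<omega>. (Z i \<omega>)\<^sup>2)" "expectation (\<lambda>\<omega>. (Z i \<omega>)\<^sup>2) = 1 / m"
      using m unfolding Z_def by (simp_all add: power_divide)
  qed
  have iidZ: "distr M borel (Z i) = distr Q borel (\<lambda>x. x / sqrt m)" if "i \<in> I" for i
    unfolding iid[OF that, symmetric] Z_def using that
    by (subst distr_distr) (auto simp: comp_def)
  obtain i0 where i0: "i0 \<in> I" using I by auto
  define S where "S = (\<lambda>i \<omega>. \<Sum>j\<in>I - {i}. Z j \<omega>)"
  have split: "S i \<omega> + Z i \<omega> = (\<Sum>j\<in>I. Z j \<omega>)" if "i \<in> I" for i \<omega>
    using that I by (simp add: S_def sum.remove[of I i] add.commute)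
  have indepS: "indep_var borel (S i) borel (Z i)" if "i \<in> I" for i
    unfolding S_def
    by (rule indep_var_swap, rule indep_vars_sum) (use that I indepZ in \<open>auto simp: insert_absorb\<close>)
  have distrS: "distr M borel (S i) = distr M borel (S i0)" if "i \<in> I" for i
    unfolding S_def using that i0 I
    by (intro distr_sum_iid_eq[where Q = "distr Q borel (\<lambda>x. x / sqrt m)"] indep_vars_subset[OF indepZ])
       (auto simp: iidZ)
  have sumsq: "integrable M (\<lambda>\<omega>. (\<Sum>j\<in>J. Z j \<omega>)\<^sup>2)" "expectation (\<lambda>\<omega>. (\<Sum>j\<in>J. Z j \<omega>)\<^sup>2) \<le> 1"
    if "J \<subseteq> I" for J
  proof -
    have *: "integrable M (\<lambda>\<omega>. (\<Sum>j\<in>J. Z j \<omega>)\<^sup>2) \<and> expectation (\<lambda>\<omega>. (\<Sum>j\<in>J. Z j \<omega>)\<^sup>2) = real (card J) * (1 / m)"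
      by (rule expectation_sum_squares)
         (use that I Z1 Z2 in \<open>auto intro: finite_subset indep_vars_subset[OF indepZ]\<close>)
    from * show "integrable M (\<lambda>\<omega>. (\<Sum>j\<in>J. Z j \<omega>)\<^sup>2)" ..
    have "card J \<le> card I" using that I by (intro card_mono)
    with * m show "expectation (\<lambda>\<omega>. (\<Sum>j\<in>J. Z j \<omega>)\<^sup>2) \<le> 1"
      by (simp add: m_def)
  qed
  interpret sp: stein_pair M "S i0" "Z i0" m
  proof
    fix f :: "real \<Rightarrow> real" and B
    assume f [measurable]: "f \<in> borel_measurable borel" and B: "\<And>w. \<bar>f w\<bar> \<le> B"
    \<comment> \<open>Exchangeability: the total can be split at \<open>i\<close> as well as at
      \<open>i0\<close>, and the pairs (\<open>S i\<close>, \<open>Z i\<close>) and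
      (\<open>S i0\<close>, \<open>Z i0\<close>) are independent with equal marginals, hence equal
      in law.\<close>
    have "expectation (\<lambda>\<omega>. Z i \<omega> * f (S i0 \<omega> + Z i0 \<omega>)) = expectation (\<lambda>\<omega>. Z i0 \<omega> * f (S i0 \<omega> + Z i0 \<omega>))"
      if "i \<in> I" for i
    proof -
      have "expectation (\<lambda>\<omega>. (\<lambda>(s, x). x * f (s + x)) (S i \<omega>, Z i \<omega>)) =
            expectation (\<lambda>\<omega>. (\<lambda>(s, x). x * f (s + x)) (S i0 \<omega>, Z i0 \<omega>))"
        using that i0 by (intro expectation_pair_eq indepS distrS) (auto simp: iidZ)
      thus ?thesis by (simp add: split[OF that] split[OF i0])
    qed
    hence "(\<Sum>i\<in>I. expectation (\<lambda>\<omega>. Z i \<omega> * f (S i0 \<omega> + Z i0 \<omega>))) =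
        m * expectation (\<lambda>\<omega>. Z i0 \<omega> * f (S i0 \<omega> + Z i0 \<omega>))"
      by (simp add: m_def)
    moreover have "expectation (\<lambda>\<omega>. (S i0 \<omega> + Z i0 \<omega>) * f (S i0 \<omega> + Z i0 \<omega>)) =
        (\<Sum>i\<in>I. expectation (\<lambda>\<omega>. Z i \<omega> * f (S i0 \<omega> + Z i0 \<omega>)))"
    proof -
      have "integrable M (\<lambda>\<omega>. Z i \<omega> * f (S i0 \<omega> + Z i0 \<omega>))" if i: "i \<in> I" for i
      proof (rule Bochner_Integration.integrable_bound[of M "\<lambda>\<omega>. B * Z i \<omega>"])
        have "S i0 \<in> borel_measurable M" unfolding S_def by measurable
        with i i0 show "random_variable borel (\<lambda>\<omega>. Z i \<omega> * f (S i0 \<omega> + Z i0 \<omega>))" by measurable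
        have "0 \<le> B" using B[of 0] by linarith
        thus "AE \<omega> in M. norm (Z i \<omega> * f (S i0 \<omega> + Z i0 \<omega>)) \<le> norm (B * Z i \<omega>)"
          using B by (auto simp: abs_mult mult.commute[of B] intro!: mult_left_mono)
      qed (use Z1[OF i] in auto)
      thus ?thesis by (simp add: split[OF i0] sum_distrib_right)
    qed
    ultimately show "expectation (\<lambda>\<omega>. (S i0 \<omega> + Z i0 \<omega>) * f (S i0 \<omega> + Z i0 \<omega>)) =
        m * expectation (\<lambda>\<omega>. Z i0 \<omega> * f (S i0 \<omega> + Z i0 \<omega>))" by simp
  next
    show "expectation (\<lambda>\<omega>. (S i0 \<omega> + Z i0 \<omega>)\<^sup>2) \<le> 1"
      using sumsq(2)[of I] by (simp add: split[OF i0])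
    show "integrable M (\<lambda>\<omega>. (S i0 \<omega>)\<^sup>2)" "expectation (\<lambda>\<omega>. (S i0 \<omega>)\<^sup>2) \<le> 1"
      unfolding S_def by (rule sumsq; blast)+
  qed (use m i0 Z1 Z2 indepS in auto)
  have "sp.\<gamma> = 1 / sqrt m * (\<integral>x. x\<^sup>2 * min \<bar>x\<bar> (sqrt m) \<partial>Q)"
  proof -
    have "m * ((x / sqrt m)\<^sup>2 * min \<bar>x / sqrt m\<bar> 1) = 1 / sqrt m * (x\<^sup>2 * min \<bar>x\<bar> (sqrt m))" for x
    proof -
      have "min \<bar>x / sqrt m\<bar> 1 = min \<bar>x\<bar> (sqrt m) / sqrt m"
        using m by (auto simp: min_def field_simps)
      thus ?thesis using m by (simp add: power_divide)
    qed
    hence "sp.\<gamma> = expectation (\<lambda>\<omega>. 1 / sqrt m * ((Y i0 \<omega>)\<^sup>2 * min \<bar>Y i0 \<omega>\<bar> (sqrt m)))"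
      unfolding sp.\<gamma>_def by (subst integral_mult_right_zero[symmetric]) (simp add: Z_def)
    also have "\<dots> = 1 / sqrt m * (\<integral>x. x\<^sup>2 * min \<bar>x\<bar> (sqrt m) \<partial>Q)"
      by (subst integral_mult_right_zero, subst transfer(1)[OF i0]) auto
    finally show ?thesis .
  qed
  moreover have "S i0 \<omega> + Z i0 \<omega> = (\<Sum>i\<in>I. Y i \<omega>) / sqrt m" for \<omega>
    unfolding split[OF i0] by (simp add: Z_def sum_divide_distrib)
  ultimately show ?thesis
    using sp.berry_esseen[of z] by (simp add: m_def)
qed

end

section \<open>The median of block means\<close>

text \<open>If fewer than half of the values reached \<open>c\<close>, let \<open>b\<close> be the
  largest value below \<open>c\<close>. Moving the minimiser down from \<open>z\<close> to
  \<open>b\<close> saves z - b on each of the majority in \<open>B\<close> and costs at most z - b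
  on each element of \<open>A\<close>, contradicting minimality. Any minimiser is covered, so the
  choice of median for even \<open>k\<close> does not matter.\<close>

lemma is_median_count_ge:
  assumes med: "is_median k a z" and "c \<le> z"
  shows "k \<le> 2 * card {j \<in> {1..k}. c \<le> a j}"
proof (rule ccontr)
  define A B where "A = {j \<in> {1..k}. c \<le> a j}" and "B = {j \<in> {1..k}. a j < c}"
  assume "\<not> k \<le> 2 * card {j \<in> {1..k}. c \<le> a j}"
  hence small: "2 * card A < k" by (simp add: A_def)
  have fin: "finite A" "finite B" and dis: "A \<inter> B = {}" and un: "A \<union> B = {1..k}"
    by (auto simp: A_def B_def)
  have "card A + card B = k" using card_Un_disjoint[OF fin dis] un by simp
  with small have less: "card A < card B" by simp
  hence "B \<noteq> {}" by auto
  define b where "b = Max (a ` B)"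
  have bB: "b \<in> a ` B" unfolding b_def using fin \<open>B \<noteq> {}\<close> by (intro Max_in) auto
  hence "b < z" using \<open>c \<le> z\<close> by (auto simp: B_def)
  have le_b: "a j \<le> b" if "j \<in> B" for j unfolding b_def using fin that by (intro Max_ge) auto
  have "(\<Sum>j=1..k. \<bar>a j - z\<bar>) - (\<Sum>j=1..k. \<bar>a j - b\<bar>) = (\<Sum>j=1..k. \<bar>a j - z\<bar> - \<bar>a j - b\<bar>)"
    by (simp add: sum_subtractf)
  also have "\<dots> = (\<Sum>j\<in>A. \<bar>a j - z\<bar> - \<bar>a j - b\<bar>) + (\<Sum>j\<in>B. \<bar>a j - z\<bar> - \<bar>a j - b\<bar>)"
    using fin dis un by (subst un[symmetric], subst sum.union_disjoint) auto
  also have "\<dots> \<ge> (\<Sum>j\<in>A. - (z - b)) + (\<Sum>j\<in>B. z - b)"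
    using \<open>b < z\<close> by (intro add_mono sum_mono) (auto dest: le_b)
  finally have "(z - b) * (real (card B) - real (card A)) \<le> (\<Sum>j=1..k. \<bar>a j - z\<bar>) - (\<Sum>j=1..k. \<bar>a j - b\<bar>)"
    by (simp add: algebra_simps)
  moreover have "0 < (z - b) * (real (card B) - real (card A))"
    using \<open>b < z\<close> less by simp
  moreover have "(\<Sum>j=1..k. \<bar>a j - z\<bar>) \<le> (\<Sum>j=1..k. \<bar>a j - b\<bar>)"
    using med unfolding is_median_def is_arg_min_linorder by simp
  ultimately show False by linarith
qed

lemma is_median_uminus:
  assumes "is_median k a z"
  shows "is_median k (\<lambda>j. - a j) (- z)"
proof -
  have "(\<Sum>j=1..k. \<bar>- a j - - z\<bar>) \<le> (\<Sum>j=1..k. \<bar>- a j - y\<bar>)" for y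
  proof -
    have "(\<Sum>j=1..k. \<bar>a j - z\<bar>) \<le> (\<Sum>j=1..k. \<bar>a j - (- y)\<bar>)"
      using assms unfolding is_median_def is_arg_min_linorder by blast
    moreover have "\<bar>- a j - - z\<bar> = \<bar>a j - z\<bar>" "\<bar>- a j - y\<bar> = \<bar>a j - (- y)\<bar>" for j by linarith+
    ultimately show ?thesis by simp
  qed
  thus ?thesis by (simp add: is_median_def is_arg_min_linorder)
qed

section \<open>Tail bounds for block majorities and random blocks\<close>

context prob_space
begin

lemma majority_bound:
  fixes T :: "nat \<Rightarrow> 'a \<Rightarrow> real"
  assumes indep: "indep_vars (\<lambda>_. borel) T {1..k}"
    and p: "\<And>j. j \<in> {1..k} \<Longrightarrow> prob {\<omega> \<in> space M. c \<le> T j \<omega>} \<le> p" and "p \<le> 1 / 2"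
  shows "prob {\<omega> \<in> space M. k \<le> 2 * card {j \<in> {1..k}. c \<le> T j \<omega>}} \<le> exp (- 2 * real k * (1 / 2 - p)\<^sup>2)"
proof (cases "k = 0")
  case False
  define X where "X = (\<lambda>j \<omega>. indicator {c..} (T j \<omega>) :: real)"
  have rv [measurable]: "random_variable borel (T j)" if "j \<in> {1..k}" for j
    using that indep by (auto simp: indep_vars_def)
  interpret Hoeffding_ineq M "{1..k}" X "\<lambda>_. 0" "\<lambda>_. 1" "\<Sum>j=1..k. expectation (X j)"
  proof unfold_locales
    show "indep_vars (\<lambda>_. borel) X {1..k}"
      unfolding X_def by (rule indep_vars_compose2[OF indep]) auto
  qed (auto simp: X_def indicator_def)
  \<comment> \<open>Taking the exact gap to k/2 makes the majority event literally a Hoeffding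
    event; \<open>p\<close> enters only through the lower bound k (1/2 - p) on this gap.\<close>
  define \<epsilon> where "\<epsilon> = real k / 2 - (\<Sum>j=1..k. expectation (X j))"
  have exp_X: "expectation (X j) \<le> p" if "j \<in> {1..k}" for j
  proof -
    have "expectation (X j) = expectation (indicator {\<omega> \<in> space M. c \<le> T j \<omega>})"
      by (intro Bochner_Integration.integral_cong) (auto simp: X_def indicator_def)
    also have "\<dots> = prob {\<omega> \<in> space M. c \<le> T j \<omega>}" by (simp add: Int_absorb2)
    finally show ?thesis using p[OF that] by simp
  qed
  have "(\<Sum>j=1..k. expectation (X j)) \<le> real k * p"
    using sum_bounded_above[of "{1..k}" "\<lambda>j. expectation (X j)" p] exp_X by simp
  hence \<epsilon>: "real k * (1 / 2 - p) \<le> \<epsilon>" by (simp add: \<epsilon>_def algebra_simps)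
  moreover have "0 \<le> real k * (1 / 2 - p)" using \<open>p \<le> 1 / 2\<close> by simp
  ultimately have "0 \<le> \<epsilon>" and sq: "(real k * (1 / 2 - p))\<^sup>2 \<le> \<epsilon>\<^sup>2" by (auto intro: power_mono)
  have "(\<Sum>j=1..k. X j \<omega>) = real (card {j \<in> {1..k}. c \<le> T j \<omega>})" for \<omega>
    by (simp add: X_def indicator_def sum.If_cases Int_def flip: of_bool_def)
  hence "{\<omega> \<in> space M. k \<le> 2 * card {j \<in> {1..k}. c \<le> T j \<omega>}}
      = {\<omega> \<in> space M. (\<Sum>j=1..k. X j \<omega>) \<ge> (\<Sum>j=1..k. expectation (X j)) + \<epsilon>}"
    by (auto simp: \<epsilon>_def)
  hence "prob {\<omega> \<in> space M. k \<le> 2 * card {j \<in> {1..k}. c \<le> T j \<omega>}} \<le> exp (- 2 * \<epsilon>\<^sup>2 / real k)"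
    using Hoeffding_ineq_ge[OF \<open>0 \<le> \<epsilon>\<close>] False by simp
  also have "\<dots> \<le> exp (- 2 * (real k * (1 / 2 - p))\<^sup>2 / real k)"
    using sq by (simp add: divide_right_mono)
  also have "(real k * (1 / 2 - p))\<^sup>2 / real k = real k * (1 / 2 - p)\<^sup>2"
    using False by (simp add: power2_eq_square)
  hence "- 2 * (real k * (1 / 2 - p))\<^sup>2 / real k = - 2 * real k * (1 / 2 - p)\<^sup>2"
    by (simp add: mult.assoc flip: times_divide_eq_right)
  finally show ?thesis .
qed simp

text \<open>Split over the finitely many values u of \<open>U\<close>; independence factors each
  piece, and the weights prob(U = u) sum to 1. This transfers bounds for fixed blocks to random
  ones.\<close>

lemma prob_mixture_le:
  assumes indep: "indep_elements M (count_space UNIV) U N V"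
    and fin: "finite (U ` space M)"
    and meas: "\<And>u. u \<in> U ` space M \<Longrightarrow> {x \<in> space N. R u x} \<in> sets N"
    and q: "\<And>u. u \<in> U ` space M \<Longrightarrow> prob {\<omega> \<in> space M. R u (V \<omega>)} \<le> q"
  shows "{\<omega> \<in> space M. R (U \<omega>) (V \<omega>)} \<in> events"
    and "prob {\<omega> \<in> space M. R (U \<omega>) (V \<omega>)} \<le> q"
proof -
  have U: "U \<in> M \<rightarrow>\<^sub>M count_space UNIV" and V: "V \<in> M \<rightarrow>\<^sub>M N"
    and ind: "indep_set (sets (vimage_algebra (space M) U (count_space UNIV)))
                        (sets (vimage_algebra (space M) V N))"
    using indep by (auto simp: indep_elements_def)
  define E where "E = (\<lambda>u. {\<omega> \<in> space M. U \<omega> = u})"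
  define F where "F = (\<lambda>u. {\<omega> \<in> space M. R u (V \<omega>)})"
  have E_eq: "E u = U -` {u} \<inter> space M" for u by (auto simp: E_def)
  have F_eq: "F u = V -` {x \<in> space N. R u x} \<inter> space M" for u
    using measurable_space[OF V] by (auto simp: F_def)
  have E: "E u \<in> sets (vimage_algebra (space M) U (count_space UNIV))" for u
    unfolding E_eq by (rule in_vimage_algebra) simp
  have F: "F u \<in> sets (vimage_algebra (space M) V N)" if "u \<in> U ` space M" for u
    unfolding F_eq by (rule in_vimage_algebra) (rule meas[OF that])
  have ev: "E u \<in> events" "u \<in> U ` space M \<Longrightarrow> F u \<in> events" for u
    unfolding E_eq F_eq by (rule measurable_sets[OF U] measurable_sets[OF V meas]; simp)+
  have eq: "{\<omega> \<in> space M. R (U \<omega>) (V \<omega>)} = (\<Union>u\<in>U ` space M. E u \<inter> F u)"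
    by (auto simp: E_def F_def)
  show "{\<omega> \<in> space M. R (U \<omega>) (V \<omega>)} \<in> events"
    unfolding eq using fin ev by (intro sets.finite_UN) auto
  note eq
  also have "prob (\<Union>u\<in>U ` space M. E u \<inter> F u) = (\<Sum>u\<in>U ` space M. prob (E u \<inter> F u))"
    using fin ev by (intro finite_measure_finite_Union) (auto simp: disjoint_family_on_def E_def)
  also have "\<dots> = (\<Sum>u\<in>U ` space M. prob (E u) * prob (F u))"
    by (intro sum.cong refl indep_setD[OF ind] E F)
  also have "\<dots> \<le> (\<Sum>u\<in>U ` space M. prob (E u) * q)"
    using q by (intro sum_mono mult_left_mono) (auto simp: F_def)
  also have "\<dots> = (\<Sum>u\<in>U ` space M. prob (E u)) * q"
    by (simp add: sum_distrib_right)
  also have "(\<Sum>u\<in>U ` space M. prob (E u)) = prob (\<Union>u\<in>U ` space M. E u)"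
    using fin ev by (intro finite_measure_finite_Union[symmetric]) (auto simp: disjoint_family_on_def E_def)
  also have "(\<Union>u\<in>U ` space M. E u) = space M" by (auto simp: E_def)
  finally show "prob {\<omega> \<in> space M. R (U \<omega>) (V \<omega>)} \<le> q" by (simp add: prob_space)
qed

text \<open>The sign \<delta> treats both tails at once: the standardised signed variable \<tau> has
  the same square and absolute value for either sign, hence the same g. The strict inequality in the
  Berry--Esseen bound has the required closed upper tail as its complement.\<close>

lemma block_tail:
  assumes P: "integrable P (\<lambda>x. x)" "(\<integral>x. x \<partial>P) = \<mu>"
      "integrable P (\<lambda>x. (x - \<mu>)\<^sup>2)" "(\<integral>x. (x - \<mu>)\<^sup>2 \<partial>P) = \<sigma>\<^sup>2" "\<sigma> > 0"
    and X: "iid_sample M P N X" and B: "B \<subseteq> {1..N}" "B \<noteq> {}" and "\<bar>\<delta>\<bar> = 1" and "0 \<le> b"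
  shows "prob {\<omega> \<in> space M. \<delta> * \<mu> + \<sigma> * b \<le> \<delta> * block_mean (\<lambda>i. X i \<omega>) B}
       \<le> 1 - \<Phi> (b * sqrt (card B)) + 44 * g_fun P \<mu> \<sigma> (card B)"
proof -
  have fin: "finite B" using B finite_subset by blast
  define m where "m = real (card B)"
  have m: "0 < m" using B fin by (simp add: m_def card_gt_0_iff)
  have X': "indep_vars (\<lambda>_. borel) X B" "\<And>i. i \<in> B \<Longrightarrow> distr M borel (X i) = P"
    using X B by (auto simp: iid_sample_def intro: indep_vars_subset)
  have rv: "random_variable borel (X i)" if "i \<in> B" for i
    using X'(1) that by (auto simp: indep_vars_def)
  obtain i0 where "i0 \<in> B" using B by auto
  interpret P: prob_space P
    unfolding X'(2)[OF \<open>i0 \<in> B\<close>, symmetric] using \<open>i0 \<in> B\<close> by (intro prob_space_distr rv)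
  have setsP [measurable_cong]: "sets P = sets borel"
    unfolding X'(2)[OF \<open>i0 \<in> B\<close>, symmetric] by simp
  have "\<delta> = 1 \<or> \<delta> = - 1" using \<open>\<bar>\<delta>\<bar> = 1\<close> by linarith
  hence \<delta>2: "\<delta>\<^sup>2 = 1" "\<delta> * \<delta> = 1" by auto
  define \<tau> where "\<tau> = (\<lambda>x. \<delta> * (x - \<mu>) / \<sigma>)"
  have [measurable]: "\<tau> \<in> borel_measurable borel" unfolding \<tau>_def by measurable
  define Y where "Y = (\<lambda>i \<omega>. \<tau> (X i \<omega>))"
  define Q where "Q = distr P borel \<tau>"
  have \<tau>2: "(\<tau> x)\<^sup>2 = (x - \<mu>)\<^sup>2 / \<sigma>\<^sup>2" for x
    using \<delta>2 by (simp add: \<tau>_def power_divide power_mult_distrib)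
  have abs\<tau>: "\<bar>\<tau> x\<bar> = \<bar>(x - \<mu>) / \<sigma>\<bar>" for x
    using \<open>\<bar>\<delta>\<bar> = 1\<close> by (simp add: \<tau>_def abs_mult)
  have int\<tau>: "integrable P \<tau>" "(\<integral>x. \<tau> x \<partial>P) = 0"
    using P(1,2) unfolding \<tau>_def by (simp_all add: P.prob_space)
  have int\<tau>2: "integrable P (\<lambda>x. (\<tau> x)\<^sup>2)" "(\<integral>x. (\<tau> x)\<^sup>2 \<partial>P) = 1"
    using P(3,4,5) unfolding \<tau>2 by simp_all
  have Q: "integrable Q (\<lambda>x. x)" "(\<integral>x. x \<partial>Q) = 0" "integrable Q (\<lambda>x. x\<^sup>2)" "(\<integral>x. x\<^sup>2 \<partial>Q) = 1"
    unfolding Q_def using int\<tau> int\<tau>2 by (simp_all add: integrable_distr_eq integral_distr)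
  have iidY: "distr M borel (Y i) = Q" if "i \<in> B" for i
    unfolding Q_def X'(2)[OF that, symmetric] Y_def using rv[OF that]
    by (subst distr_distr) (auto simp: comp_def)
  have indepY: "indep_vars (\<lambda>_. borel) Y B"
    unfolding Y_def by (rule indep_vars_compose2[OF X'(1)]) simp
  have g: "1 / sqrt m * (\<integral>x. x\<^sup>2 * min \<bar>x\<bar> (sqrt m) \<partial>Q) = g_fun P \<mu> \<sigma> m"
    unfolding Q_def g_fun_def by (subst integral_distr) (auto simp: \<tau>2 abs\<tau> power_divide)
  have sum_eq: "(\<Sum>i\<in>B. Y i \<omega>) / sqrt m < b * sqrt m \<longleftrightarrow> \<not> \<delta> * \<mu> + \<sigma> * b \<le> \<delta> * block_mean (\<lambda>i. X i \<omega>) B"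
    for \<omega>
  proof -
    have mean: "(\<Sum>i\<in>B. X i \<omega>) = m * block_mean (\<lambda>i. X i \<omega>) B"
      using m by (simp add: block_mean_def m_def)
    have "(\<Sum>i\<in>B. Y i \<omega>) = \<delta> * ((\<Sum>i\<in>B. X i \<omega>) - m * \<mu>) / \<sigma>"
      by (simp add: Y_def \<tau>_def m_def sum_subtractf flip: sum_divide_distrib sum_distrib_left)
    also have "\<dots> = m * ((\<delta> * block_mean (\<lambda>i. X i \<omega>) B - \<delta> * \<mu>) / \<sigma>)"
      unfolding mean by (simp add: algebra_simps)
    finally have sumY: "(\<Sum>i\<in>B. Y i \<omega>) = m * ((\<delta> * block_mean (\<lambda>i. X i \<omega>) B - \<delta> * \<mu>) / \<sigma>)" .
    have "(\<Sum>i\<in>B. Y i \<omega>) / sqrt m < b * sqrt m \<longleftrightarrow> (\<Sum>i\<in>B. Y i \<omega>) < m * b"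
      using m by (simp add: divide_less_eq ac_simps flip: mult.assoc[of "sqrt m" "sqrt m"])
    also have "\<dots> \<longleftrightarrow> (\<delta> * block_mean (\<lambda>i. X i \<omega>) B - \<delta> * \<mu>) / \<sigma> < b"
      unfolding sumY using m by (rule mult_less_cancel_left_pos)
    also have "\<dots> \<longleftrightarrow> \<not> \<delta> * \<mu> + \<sigma> * b \<le> \<delta> * block_mean (\<lambda>i. X i \<omega>) B"
      using \<open>\<sigma> > 0\<close> by (simp add: divide_less_eq mult.commute) linarith
    finally show ?thesis .
  qed
  have meas: "{\<omega> \<in> space M. (\<Sum>i\<in>B. Y i \<omega>) / sqrt m < b * sqrt m} \<in> events"
  proof -
    have "random_variable borel (Y i)" if "i \<in> B" for i
      using rv[OF that] unfolding Y_def by measurable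
    hence "random_variable borel (\<lambda>\<omega>. (\<Sum>i\<in>B. Y i \<omega>) / sqrt m)"
      by (intro borel_measurable_divide borel_measurable_sum) auto
    thus ?thesis by measurable
  qed
  have "{\<omega> \<in> space M. \<delta> * \<mu> + \<sigma> * b \<le> \<delta> * block_mean (\<lambda>i. X i \<omega>) B}
      = space M - {\<omega> \<in> space M. (\<Sum>i\<in>B. Y i \<omega>) / sqrt m < b * sqrt m}"
    unfolding sum_eq by auto
  hence "prob {\<omega> \<in> space M. \<delta> * \<mu> + \<sigma> * b \<le> \<delta> * block_mean (\<lambda>i. X i \<omega>) B}
      = 1 - prob {\<omega> \<in> space M. (\<Sum>i\<in>B. Y i \<omega>) / sqrt m < b * sqrt m}"
    using meas by (simp add: prob_compl)
  also have "\<dots> \<le> 1 - \<Phi> (b * sqrt m) + 44 * g_fun P \<mu> \<sigma> m"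
    using berry_esseen_iid[OF fin B(2) indepY iidY Q, of "b * sqrt m"]
    unfolding m_def[symmetric] g by linarith
  finally show ?thesis by (simp add: m_def)
qed

text \<open>For fixed blocks, the signed block means are independent and each exceeds the threshold
  with probability at most 1/2 - D, so \<open>majority_bound\<close> applies;
  \<open>prob_mixture_le\<close> then restores the randomness of the blocks.\<close>

lemma mom_one_sided:
  assumes P: "integrable P (\<lambda>x. x)" "(\<integral>x. x \<partial>P) = \<mu>"
      "integrable P (\<lambda>x. (x - \<mu>)\<^sup>2)" "(\<integral>x. (x - \<mu>)\<^sup>2 \<partial>P) = \<sigma>\<^sup>2" "\<sigma> > 0"
    and X: "iid_sample M P N X" and G: "random_blocks M k N X G"
    and "0 < N div k" and "\<bar>\<delta>\<bar> = 1" and "0 \<le> b" and "0 \<le> D"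
    and D: "1 - \<Phi> (b * sqrt (real (N div k))) + 44 * g_fun P \<mu> \<sigma> (real (N div k)) \<le> 1 / 2 - D"
  defines "E \<equiv> {\<omega> \<in> space M. k \<le> 2 * card {j \<in> {1..k}.
      \<delta> * \<mu> + \<sigma> * b \<le> \<delta> * block_mean (\<lambda>i. X i \<omega>) (G \<omega> j)}}"
  shows "E \<in> events" and "prob E \<le> exp (- 2 * real k * D\<^sup>2)"
proof -
  define c where "c = \<delta> * \<mu> + \<sigma> * b"
  define R where "R = (\<lambda>u x. k \<le> 2 * card {j \<in> {1..k}. c \<le> \<delta> * block_mean x (u j)})"
  define U where "U = (\<lambda>\<omega>. restrict (G \<omega>) {1..k})"
  define V where "V = (\<lambda>\<omega>. \<lambda>i\<in>{1..N}. X i \<omega>)"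
  have fam: "is_block_family k N (G \<omega>)" if "\<omega> \<in> space M" for \<omega>
    using G that by (auto simp: random_blocks_def)
  have indep: "indep_elements M (count_space UNIV) U (PiM {1..N} (\<lambda>_. borel)) V"
    using G by (simp add: random_blocks_def U_def V_def)
  have famU: "is_block_family k N u" if "u \<in> U ` space M" for u
  proof -
    from that obtain \<omega> where \<omega>: "\<omega> \<in> space M" "u = U \<omega>" by blast
    hence "u j = G \<omega> j" if "j \<in> {1..k}" for j using that by (simp add: U_def)
    with fam[OF \<omega>(1)] show ?thesis by (simp add: is_block_family_def disjoint_family_on_def)
  qed
  \<comment> \<open>\<open>V\<close> is \<open>undefined\<close> outside {1..N}, but block means
    read only indices inside it.\<close>
  have R_cong: "R u (V \<omega>) \<longleftrightarrow> R u (\<lambda>i. X i \<omega>)" if "is_block_family k N u" for u \<omega>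
  proof -
    have "block_mean (V \<omega>) (u j) = block_mean (\<lambda>i. X i \<omega>) (u j)" if "j \<in> {1..k}" for j
    proof -
      have "u j \<subseteq> {1..N}" using that \<open>is_block_family k N u\<close> by (simp add: is_block_family_def)
      thus ?thesis unfolding block_mean_def V_def
        by (intro arg_cong2[where f = "(/)"] sum.cong restrict_apply' refl) auto
    qed
    hence "{j \<in> {1..k}. c \<le> \<delta> * block_mean (V \<omega>) (u j)} = {j \<in> {1..k}. c \<le> \<delta> * block_mean (\<lambda>i. X i \<omega>) (u j)}"
      by auto
    thus ?thesis by (simp only: R_def)
  qed
  have "finite (U ` space M)"
  proof (rule finite_subset)
    show "U ` space M \<subseteq> PiE {1..k} (\<lambda>_. Pow {1..N})"
    proof
      fix u assume "u \<in> U ` space M"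
      with famU[OF this] show "u \<in> PiE {1..k} (\<lambda>_. Pow {1..N})"
        by (intro PiE_I) (auto simp: is_block_family_def U_def)
    qed
  qed (intro finite_PiE; simp)
  moreover have "{x \<in> space (PiM {1..N} (\<lambda>_. borel)). R u x} \<in> sets (PiM {1..N} (\<lambda>_. borel))"
    if "u \<in> U ` space M" for u
  proof -
    have "(\<lambda>x. block_mean x (u j)) \<in> borel_measurable (PiM {1..N} (\<lambda>_. borel))" if "j \<in> {1..k}" for j
    proof -
      have "u j \<subseteq> {1..N}" using that famU[OF \<open>u \<in> U ` space M\<close>] by (simp add: is_block_family_def)
      thus ?thesis unfolding block_mean_def
        by (intro borel_measurable_divide borel_measurable_sum measurable_component_singleton) auto
    qed
    \<comment> \<open>The count of large blocks is written as a sum of indicators to make it visibly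
      measurable.\<close>
    hence "(\<lambda>x. \<Sum>j=1..k. indicator {c..} (\<delta> * block_mean x (u j)) :: real)
        \<in> borel_measurable (PiM {1..N} (\<lambda>_. borel))"
      by (intro borel_measurable_sum) measurable
    hence "{x \<in> space (PiM {1..N} (\<lambda>_. borel)).
        real k \<le> 2 * (\<Sum>j=1..k. indicator {c..} (\<delta> * block_mean x (u j)) :: real)} \<in> sets (PiM {1..N} (\<lambda>_. borel))"
      by measurable
    moreover have "(\<Sum>j=1..k. indicator {c..} (\<delta> * block_mean x (u j)) :: real)
        = real (card {j \<in> {1..k}. c \<le> \<delta> * block_mean x (u j)})" for x
      by (simp add: indicator_def sum.If_cases Int_def flip: of_bool_def)
    moreover have "R u x \<longleftrightarrow> real k \<le> 2 * real (card {j \<in> {1..k}. c \<le> \<delta> * block_mean x (u j)})" for x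
      unfolding R_def by linarith
    ultimately show ?thesis by (simp only:)
  qed
  moreover have "prob {\<omega> \<in> space M. R u (V \<omega>)} \<le> exp (- 2 * real k * D\<^sup>2)" if "u \<in> U ` space M" for u
  proof -
    have u: "disjoint_family_on u {1..k}" "\<And>j. j \<in> {1..k} \<Longrightarrow> u j \<subseteq> {1..N}"
        "\<And>j. j \<in> {1..k} \<Longrightarrow> card (u j) = N div k"
      using famU[OF that] by (simp_all only: is_block_family_def)
    have X': "indep_vars (\<lambda>_. borel) X {1..N}" using X by (simp add: iid_sample_def)
    \<comment> \<open>Each block mean is a function of the sample restricted to its own block, and
      restrictions to disjoint blocks are independent.\<close>
    have "indep_vars (\<lambda>_. borel) (\<lambda>j \<omega>. \<delta> * block_mean (restrict (\<lambda>i. X i \<omega>) (u j)) (u j)) {1..k}"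
      using indep_vars_restrict[OF X' u(2) u(1)]
    proof (rule indep_vars_compose2)
      show "(\<lambda>x. \<delta> * block_mean x (u j)) \<in> borel_measurable (PiM (u j) (\<lambda>_. borel))" for j
        unfolding block_mean_def
        by (intro borel_measurable_times borel_measurable_divide borel_measurable_sum measurable_component_singleton) auto
    qed
    moreover have "block_mean (restrict x (u j)) (u j) = block_mean x (u j)" for x :: "nat \<Rightarrow> real" and j
      by (simp add: block_mean_def)
    ultimately have iv: "indep_vars (\<lambda>_. borel) (\<lambda>j \<omega>. \<delta> * block_mean (\<lambda>i. X i \<omega>) (u j)) {1..k}"
      by simp
    have "prob {\<omega> \<in> space M. k \<le> 2 * card {j \<in> {1..k}. c \<le> \<delta> * block_mean (\<lambda>i. X i \<omega>) (u j)}}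
        \<le> exp (- 2 * real k * (1 / 2 - (1 / 2 - D))\<^sup>2)"
    proof (rule majority_bound[OF iv])
      fix j assume j: "j \<in> {1..k}"
      have "u j \<noteq> {}" using u(3)[OF j] \<open>0 < N div k\<close> by auto
      from block_tail[OF P X u(2)[OF j] this \<open>\<bar>\<delta>\<bar> = 1\<close> \<open>0 \<le> b\<close>] D
      show "prob {\<omega> \<in> space M. c \<le> \<delta> * block_mean (\<lambda>i. X i \<omega>) (u j)} \<le> 1 / 2 - D"
        unfolding c_def u(3)[OF j] by (rule order.trans)
    qed (use \<open>0 \<le> D\<close> in simp)
    thus ?thesis unfolding R_cong[OF famU[OF that]] by (simp add: R_def)
  qed
  ultimately have "{\<omega> \<in> space M. R (U \<omega>) (V \<omega>)} \<in> events"
    "prob {\<omega> \<in> space M. R (U \<omega>) (V \<omega>)} \<le> exp (- 2 * real k * D\<^sup>2)"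
    by (rule prob_mixture_le[OF indep, of R]; blast)+
  moreover have "{\<omega> \<in> space M. R (U \<omega>) (V \<omega>)} = E"
  proof -
    have "R (U \<omega>) (V \<omega>) \<longleftrightarrow> R (G \<omega>) (\<lambda>i. X i \<omega>)" if "\<omega> \<in> space M" for \<omega>
    proof -
      have "{j \<in> {1..k}. c \<le> \<delta> * block_mean (\<lambda>i. X i \<omega>) (U \<omega> j)} = {j \<in> {1..k}. c \<le> \<delta> * block_mean (\<lambda>i. X i \<omega>) (G \<omega> j)}"
        by (auto simp: U_def)
      thus ?thesis using R_cong[OF famU[of "U \<omega>"]] that by (simp add: R_def)
    qed
    thus ?thesis unfolding E_def R_def c_def by (auto simp only:)
  qed
  ultimately show "E \<in> events" "prob E \<le> exp (- 2 * real k * D\<^sup>2)" by simp_all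
qed

text \<open>A deviation by sqrt(t/N) in units of \<sigma> becomes \<open>s\<close> after normalising
  a block mean. Where the Berry--Esseen error exceeds the normal gain, \<open>max 0\<close> turns
  the right side into the trivial bound 2, so the estimate holds for all t \<ge> 0 and its exponent
  can define the o(1) term.\<close>

lemma mom_tail:
  assumes P: "integrable P (\<lambda>x. x)" "(\<integral>x. x \<partial>P) = \<mu>"
      "integrable P (\<lambda>x. (x - \<mu>)\<^sup>2)" "(\<integral>x. (x - \<mu>)\<^sup>2 \<partial>P) = \<sigma>\<^sup>2" "\<sigma> > 0"
    and X: "iid_sample M P N X" and G: "random_blocks M k N X G" and mom: "is_MOM M k X G \<mu>hat"
    and k: "1 \<le> k" "real k \<le> real N / 2" and "0 \<le> t"
  defines "s \<equiv> sqrt (t / real N) * sqrt (real (N div k))"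
  shows "prob {\<omega> \<in> space M. \<bar>sqrt (real N) * (\<mu>hat \<omega> - \<mu>)\<bar> \<ge> \<sigma> * sqrt t}
    \<le> 2 * exp (- 2 * real k * (max 0 (s * std_normal_density s - 44 * g_fun P \<mu> \<sigma> (real (N div k))))\<^sup>2)"
    (is "prob ?L \<le> 2 * exp (- 2 * real k * (max 0 ?D)\<^sup>2)")
proof (cases "0 \<le> ?D")
  case False
  have "prob ?L \<le> 1" by (rule prob_le_1)
  also have "1 \<le> 2 * exp (- 2 * real k * (max 0 ?D)\<^sup>2)" using False by simp
  finally show ?thesis .
next
  case True
  have N: "0 < real N" using k by simp
  have "k \<le> N" using k by simp
  hence pos: "0 < N div k" using k by (simp add: div_greater_zero_iff)
  define b where "b = sqrt (t / real N)"
  have "0 \<le> b" using \<open>0 \<le> t\<close> by (simp add: b_def)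
  have "0 \<le> s" using \<open>0 \<le> t\<close> by (simp add: s_def)
  from cdf_std_normal_ge[OF this]
  have D: "1 - \<Phi> (b * sqrt (real (N div k))) + 44 * g_fun P \<mu> \<sigma> (real (N div k)) \<le> 1 / 2 - ?D"
    unfolding b_def s_def[symmetric] by linarith
  define E where "E = (\<lambda>\<delta>. {\<omega> \<in> space M. k \<le> 2 * card {j \<in> {1..k}.
      \<delta> * \<mu> + \<sigma> * b \<le> \<delta> * block_mean (\<lambda>i. X i \<omega>) (G \<omega> j)}})"
  have E: "E \<delta> \<in> events" "prob (E \<delta>) \<le> exp (- 2 * real k * ?D\<^sup>2)" if "\<bar>\<delta>\<bar> = 1" for \<delta>
    unfolding E_def by (rule mom_one_sided[OF P X G pos that \<open>0 \<le> b\<close> True D])+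
  have "?L \<subseteq> E 1 \<union> E (- 1)"
  proof
    fix \<omega> assume "\<omega> \<in> ?L"
    hence \<omega>: "\<omega> \<in> space M" and "\<sigma> * sqrt t \<le> sqrt (real N) * \<bar>\<mu>hat \<omega> - \<mu>\<bar>"
      by (auto simp: abs_mult)
    moreover have "\<sigma> * sqrt t = sqrt (real N) * (\<sigma> * b)"
      using N by (simp add: b_def real_sqrt_divide)
    ultimately have "\<sigma> * b \<le> \<bar>\<mu>hat \<omega> - \<mu>\<bar>"
      using N by (simp only: mult_le_cancel_left_pos real_sqrt_gt_zero)
    moreover have med: "is_median k (\<lambda>j. block_mean (\<lambda>i. X i \<omega>) (G \<omega> j)) (\<mu>hat \<omega>)"
      using mom \<omega> by (simp add: is_MOM_def)
    ultimately consider "1 * \<mu> + \<sigma> * b \<le> \<mu>hat \<omega>" | "- 1 * \<mu> + \<sigma> * b \<le> - \<mu>hat \<omega>" by linarith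
    thus "\<omega> \<in> E 1 \<union> E (- 1)"
    proof cases
      case 1
      from is_median_count_ge[OF med this] \<omega> show ?thesis by (simp add: E_def)
    next
      case 2
      from is_median_count_ge[OF is_median_uminus[OF med] this] \<omega> show ?thesis by (simp add: E_def)
    qed
  qed
  hence "prob ?L \<le> prob (E 1 \<union> E (- 1))" by (intro finite_measure_mono sets.Un E) simp_all
  also have "\<dots> \<le> prob (E 1) + prob (E (- 1))" by (intro measure_Un_le E) simp_all
  also have "\<dots> \<le> 2 * exp (- 2 * real k * ?D\<^sup>2)" using E(2)[of 1] E(2)[of "- 1"] by simp
  finally show ?thesis using True by simp
qed

end

section \<open>Asymptotics of the exponent\<close>

lemma g_fun_nonneg: "0 \<le> g_fun P \<mu> \<sigma> m"
proof (cases "0 \<le> m")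
  case True
  thus ?thesis unfolding g_fun_def
    by (intro mult_nonneg_nonneg Bochner_Integration.integral_nonneg) auto
next
  \<comment> \<open>In HOL the square root of a negative number is negative: the minimum is then
    \<open>sqrt m\<close>, whose sign cancels against the prefactor.\<close>
  case False
  hence "min \<bar>(x - \<mu>) / \<sigma>\<bar> (sqrt m) = sqrt m" for x by (intro min_absorb2) (auto intro: order.trans[of _ 0])
  thus ?thesis unfolding g_fun_def using False by (simp add: zero_le_mult_iff)
qed

text \<open>Passes from the block size m, which is N/k rounded down, to N/k itself, where the growth
  condition on \<open>l\<close> is stated. The integral increases with the argument, and the
  prefactor changes by at most sqrt 2.\<close>

lemma g_fun_le_sqrt2:
  assumes sets: "sets P = sets borel" and int: "integrable P (\<lambda>x. (x - \<mu>)\<^sup>2)"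
    and "0 < m" "m \<le> m'" "m' \<le> 2 * m"
  shows "g_fun P \<mu> \<sigma> m \<le> sqrt 2 * g_fun P \<mu> \<sigma> m'"
proof -
  note [measurable_cong] = sets
  have ints: "integrable P (\<lambda>x. ((x - \<mu>) / \<sigma>)\<^sup>2 * min \<bar>(x - \<mu>) / \<sigma>\<bar> (sqrt a))" if "0 \<le> a" for a
  proof (rule Bochner_Integration.integrable_bound[of P "\<lambda>x. ((x - \<mu>)\<^sup>2 / \<sigma>\<^sup>2) * sqrt a"])
    show "AE x in P. norm (((x - \<mu>) / \<sigma>)\<^sup>2 * min \<bar>(x - \<mu>) / \<sigma>\<bar> (sqrt a)) \<le> norm ((x - \<mu>)\<^sup>2 / \<sigma>\<^sup>2 * sqrt a)"
      using that by (intro AE_I2) (auto simp: power_divide abs_mult intro!: divide_right_mono mult_left_mono)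
  qed (use int in auto)
  have "sqrt m' \<le> sqrt 2 * sqrt m"
    using assms by (simp flip: real_sqrt_mult)
  hence "1 / sqrt m \<le> sqrt 2 / sqrt m'"
    using assms by (simp add: field_simps)
  hence "g_fun P \<mu> \<sigma> m \<le> sqrt 2 / sqrt m' * (\<integral>x. ((x - \<mu>) / \<sigma>)\<^sup>2 * min \<bar>(x - \<mu>) / \<sigma>\<bar> (sqrt m') \<partial>P)"
    unfolding g_fun_def using assms
    by (intro mult_mono integral_mono ints mult_left_mono min.mono Bochner_Integration.integral_nonneg) auto
  thus ?thesis by (simp add: g_fun_def)
qed

text \<open>The three errors have separate sources: k/N from observations outside all blocks, u/k
  from replacing exp(- s^2 / 2) by 1, and the square root from the Berry--Esseen error relative to
  \<open>s\<close>. Only the last two pass through the square of the gap, which doubles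
  them.\<close>

lemma exponent_deviation:
  fixes \<sigma> :: real
  assumes sets: "sets P = sets borel" and int: "integrable P (\<lambda>x. (x - \<mu>)\<^sup>2)"
    and k: "1 \<le> k" and N: "2 * k \<le> N" and l: "0 < l" and t: "l \<le> t" "t \<le> u"
  defines "s \<equiv> sqrt (t / real N) * sqrt (real (N div k))"
  defines "D \<equiv> max 0 (s * std_normal_density s - 44 * g_fun P \<mu> \<sigma> (real (N div k)))"
  shows "\<bar>2 * real k * pi * D\<^sup>2 / t - 1\<bar>
    \<le> real k / real N + u / real k + 528 * sqrt (real k * (g_fun P \<mu> \<sigma> (real N / real k))\<^sup>2 / l)"
proof -
  define m where "m = real (N div k)"
  define K n where "K = real k" and "n = real N"
  \<comment> \<open>The fraction of the sample covered by the blocks; it lies in [1/2, 1] and s^2 =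
    r t / k.\<close>
  define r where "r = K * m / n"
  define g where "g = g_fun P \<mu> \<sigma> m"
  define g' where "g' = g_fun P \<mu> \<sigma> (n / K)"
  define C where "C = 44 * sqrt (2 * pi)"
  have K: "1 \<le> K" and n: "2 * K \<le> n" "0 < n"
    using k N unfolding K_def n_def by linarith+
  have "0 < t" using l t by simp
  have "K * m \<le> n" unfolding K_def m_def n_def
    by (metis of_nat_le_iff of_nat_mult mult.commute div_times_less_eq_dividend)
  have "n < K * m + K"
  proof -
    have "N < k * (N div k) + k"
      using k mod_less_divisor[of k N] mult_div_mod_eq[of k N] by linarith
    thus ?thesis unfolding K_def m_def n_def by (metis of_nat_less_iff of_nat_add of_nat_mult)
  qed
  have m: "0 < m"
    using \<open>n < K * m + K\<close> n K by (smt (verit) mult_nonneg_nonpos)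
  have nm: "n \<le> 2 * (K * m)" using \<open>n < K * m + K\<close> n by linarith
  have r: "0 < r" "r \<le> 1" "1 \<le> 2 * r"
    using \<open>K * m \<le> n\<close> n K m nm by (auto simp: r_def field_simps)
  have r_ge: "1 - r \<le> K / n"
  proof -
    have "1 - r = (n - K * m) / n" using n by (simp add: r_def diff_divide_distrib)
    also have "\<dots> \<le> K / n" using \<open>n < K * m + K\<close> n by (intro divide_right_mono) auto
    finally show ?thesis .
  qed
  have s2: "s\<^sup>2 = t * m / n"
    using \<open>0 < t\<close> n m by (simp add: s_def power_mult_distrib flip: m_def n_def)
  have "0 < s" using \<open>0 < t\<close> n m by (simp add: s_def flip: m_def n_def)
  define h where "h = C * g / s"
  have "0 \<le> g" unfolding g_def by (rule g_fun_nonneg)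
  have "0 \<le> C" by (simp add: C_def)
  have "0 \<le> h" using \<open>0 \<le> g\<close> \<open>0 < s\<close> \<open>0 \<le> C\<close> by (simp add: h_def)
  \<comment> \<open>The gap in units of its leading term s / sqrt(2 pi). In these units the exponent
    ratio is exactly r times (max 0 x)^2, and only r and x close to 1 have to be shown.\<close>
  define x where "x = exp (- s\<^sup>2 / 2) - h"
  have D_eq: "D = s / sqrt (2 * pi) * max 0 x"
  proof -
    have "s * std_normal_density s - 44 * g = s / sqrt (2 * pi) * x"
      using \<open>0 < s\<close> by (simp add: std_normal_density_def x_def h_def C_def field_simps)
    moreover have "max 0 (c * y) = c * max 0 y" if "0 < c" for c y :: real
      using that by (auto simp: max_def mult_le_0_iff zero_le_mult_iff)
    moreover have "0 < s / sqrt (2 * pi)" using \<open>0 < s\<close> by simp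
    ultimately show ?thesis unfolding D_def m_def[symmetric] g_def[symmetric] by (simp only:)
  qed
  have ratio: "2 * real k * pi * D\<^sup>2 / t = r * (max 0 x)\<^sup>2"
    using \<open>0 < t\<close> n
    by (simp add: D_eq power_mult_distrib power_divide s2 r_def K_def field_simps)
  have a: "s\<^sup>2 / 2 \<le> u / K / 2"
  proof -
    have "s\<^sup>2 = t / K * r" using K by (simp add: s2 r_def)
    also have "\<dots> \<le> u / K * 1" using t r K \<open>0 < t\<close> by (intro mult_mono divide_right_mono) auto
    finally show ?thesis by simp
  qed
  have h_le: "h \<le> 264 * sqrt (K * g'\<^sup>2 / l)"
  proof -
    have "g \<le> sqrt 2 * g'" unfolding g_def g'_def
    proof (rule g_fun_le_sqrt2[OF sets int m])
      show "m \<le> n / K" "n / K \<le> 2 * m" using \<open>K * m \<le> n\<close> nm K by (auto simp: field_simps)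
    qed
    hence "g\<^sup>2 \<le> 2 * g'\<^sup>2" using \<open>0 \<le> g\<close> power_mono[of g "sqrt 2 * g'" 2] by (simp add: power_mult_distrib)
    moreover have "l / (2 * K) \<le> s\<^sup>2"
    proof -
      have "l * (1 / 2) / K \<le> t * r / K"
        using t l r K by (intro divide_right_mono mult_mono) auto
      hence "l / (2 * K) \<le> t * r / K" by simp
      also have "\<dots> = s\<^sup>2" using K by (simp add: s2 r_def)
      finally show ?thesis .
    qed
    ultimately have "g\<^sup>2 / s\<^sup>2 \<le> (2 * g'\<^sup>2) / (l / (2 * K))"
      using l K by (intro frac_le) auto
    also have "\<dots> = 4 * (K * g'\<^sup>2 / l)" using l K by (simp add: field_simps)
    finally have "(g / s)\<^sup>2 \<le> 4 * (K * g'\<^sup>2 / l)" by (simp add: power_divide)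
    hence "g / s \<le> sqrt (4 * (K * g'\<^sup>2 / l))" by (rule real_le_rsqrt)
    also have "\<dots> = 2 * sqrt (K * g'\<^sup>2 / l)" unfolding real_sqrt_mult[of 4] by simp
    finally have "C * (g / s) \<le> C * (2 * sqrt (K * g'\<^sup>2 / l))" using \<open>0 \<le> C\<close> by (rule mult_left_mono)
    hence "h \<le> (2 * C) * sqrt (K * g'\<^sup>2 / l)" by (simp add: h_def)
    \<comment> \<open>Since sqrt(2 pi) \<le> 3, the constant 2 C is at most 2 * 44 * 3 = 264;
      doubling it in the final estimate gives 528.\<close>
    also have "\<dots> \<le> 264 * sqrt (K * g'\<^sup>2 / l)"
    proof (rule mult_right_mono)
      have "sqrt (2 * pi) \<le> 3" using pi_less_4 by (intro real_le_lsqrt) auto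
      thus "2 * C \<le> 264" by (simp add: C_def)
    qed (use K l in simp)
    finally show ?thesis .
  qed
  have "1 - s\<^sup>2 / 2 - h \<le> x"
    using exp_ge_add_one_self[of "- s\<^sup>2 / 2"] by (simp add: x_def)
  moreover have "x \<le> 1"
  proof -
    have "exp (- s\<^sup>2 / 2) \<le> 1" by simp
    with \<open>0 \<le> h\<close> show ?thesis unfolding x_def by linarith
  qed
  ultimately have X: "0 \<le> max 0 x" "max 0 x \<le> 1" "1 - max 0 x \<le> s\<^sup>2 / 2 + h" by auto
  have "r * (max 0 x)\<^sup>2 \<le> 1 * 1"
    using r X by (intro mult_mono power_le_one) auto
  \<comment> \<open>With y = max 0 x in [0, 1], this is 1 - r y^2 = (1 - r) + r (1 - y) (1 +
    y).\<close>
  moreover have "1 - r * (max 0 x)\<^sup>2 \<le> (1 - r) + 2 * (1 - max 0 x)"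
  proof -
    have "1 - r * (max 0 x)\<^sup>2 = (1 - r) + r * ((1 - max 0 x) * (1 + max 0 x))"
      by (simp add: algebra_simps power2_eq_square)
    also have "r * ((1 - max 0 x) * (1 + max 0 x)) \<le> 1 * ((1 - max 0 x) * 2)"
      using r X by (intro mult_mono mult_left_mono mult_nonneg_nonneg) auto
    finally show ?thesis by simp
  qed
  ultimately have "\<bar>r * (max 0 x)\<^sup>2 - 1\<bar> \<le> K / n + 2 * (s\<^sup>2 / 2 + h)"
    using r_ge X(3) by (subst abs_of_nonpos; simp)
  also have "\<dots> \<le> K / n + u / K + 528 * sqrt (K * g'\<^sup>2 / l)"
    using a h_le by simp
  finally show ?thesis unfolding ratio by (simp add: K_def n_def g'_def)
qed

theorem theorem2p1:
  fixes P :: "real measure" and \<mu> \<sigma> :: real and l u :: "nat \<Rightarrow> nat \<Rightarrow> real"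
  assumes "prob_space P" and "sets P = sets borel"
    and "integrable P (\<lambda>x. x)" and "(\<integral>x. x \<partial>P) = \<mu>"
    and "integrable P (\<lambda>x. (x - \<mu>)\<^sup>2)" and "(\<integral>x. (x - \<mu>)\<^sup>2 \<partial>P) = \<sigma>\<^sup>2" and "\<sigma> > 0"
    and "much_less kN_limit
           (\<lambda>(k, N). real k * (g_fun P \<mu> \<sigma> (real N / real k))\<^sup>2) (\<lambda>(k, N). l k N)"
    and "much_less kN_limit (\<lambda>(k, N). u k N) (\<lambda>(k, N). real k)"
  shows "\<exists>\<epsilon> :: nat \<Rightarrow> nat \<Rightarrow> real \<Rightarrow> real.
    (\<forall>e>0. \<forall>\<^sub>F (k, N) in kN_limit. \<forall>t\<in>{l k N..u k N}. \<bar>\<epsilon> k N t\<bar> < e) \<and>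
    (\<forall>k N. 1 \<le> k \<longrightarrow> real k \<le> real N / 2 \<longrightarrow>
      (\<forall>(M :: 'w measure) (X :: nat \<Rightarrow> 'w \<Rightarrow> real) (G :: 'w \<Rightarrow> nat \<Rightarrow> nat set) (\<mu>hat :: 'w \<Rightarrow> real).
        prob_space M \<longrightarrow> iid_sample M P N X \<longrightarrow> random_blocks M k N X G \<longrightarrow>
        is_MOM M k X G \<mu>hat \<longrightarrow>
        (\<forall>t\<in>{l k N..u k N}.
          measure M {\<omega> \<in> space M. \<bar>sqrt (real N) * (\<mu>hat \<omega> - \<mu>)\<bar> \<ge> \<sigma> * sqrt t}
            \<le> 2 * exp (- (t / pi) * (1 + \<epsilon> k N t)))))"
proof -
  interpret P: prob_space P by fact
  define D where "D = (\<lambda>k N t. max 0 (sqrt (t / real N) * sqrt (real (N div k))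
      * std_normal_density (sqrt (t / real N) * sqrt (real (N div k))) - 44 * g_fun P \<mu> \<sigma> (real (N div k))))"
  \<comment> \<open>Solved from - (t / pi) (1 + \<epsilon>) = - 2 k D^2, so \<open>mom_tail\<close>
    is already the claimed inequality. It refers to no sample space, which permits choosing it
    before \<open>M\<close>, \<open>X\<close>, \<open>G\<close> and the estimator.\<close>
  define \<epsilon> where "\<epsilon> = (\<lambda>k N t. if 0 < t then 2 * real k * pi * (D k N t)\<^sup>2 / t - 1 else 0)"
  have "\<forall>\<^sub>F (k, N) in kN_limit. \<forall>t\<in>{l k N..u k N}. \<bar>\<epsilon> k N t\<bar> < e" if "0 < e" for e
  proof -
    have lim1: "filterlim fst at_top kN_limit" "filterlim (\<lambda>(k, N). real N / real k) at_top kN_limit"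
      by (auto simp: kN_limit_def filterlim_iff_le_filtercomap)
    have "((\<lambda>p. inverse ((\<lambda>(k, N). real N / real k) p)) \<longlongrightarrow> 0) kN_limit"
      by (rule tendsto_inverse_0_at_top[OF lim1(2)])
    hence lim2: "((\<lambda>(k, N). real k / real N) \<longlongrightarrow> 0) kN_limit"
      by (simp add: case_prod_unfold)
    have lim3: "((\<lambda>(k, N). u k N / real k) \<longlongrightarrow> 0) kN_limit"
      using assms(9) by (simp add: much_less_def case_prod_unfold)
    have lim_g: "((\<lambda>(k, N). real k * (g_fun P \<mu> \<sigma> (real N / real k))\<^sup>2 / l k N) \<longlongrightarrow> 0) kN_limit"
      and l_pos: "\<forall>\<^sub>F (k, N) in kN_limit. 0 < l k N"
      using assms(8) by (simp_all add: much_less_def case_prod_unfold)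
    have lim4: "((\<lambda>(k, N). sqrt (real k * (g_fun P \<mu> \<sigma> (real N / real k))\<^sup>2 / l k N)) \<longlongrightarrow> sqrt 0) kN_limit"
      using lim_g unfolding case_prod_unfold by (rule tendsto_real_sqrt)
    have "((\<lambda>(k, N). real k / real N + u k N / real k
        + 528 * sqrt (real k * (g_fun P \<mu> \<sigma> (real N / real k))\<^sup>2 / l k N)) \<longlongrightarrow> 0 + 0 + 528 * sqrt 0) kN_limit"
      using lim2 lim3 lim4 unfolding case_prod_unfold by (intro tendsto_add tendsto_mult_left)
    hence "\<forall>\<^sub>F p in kN_limit. (\<lambda>(k, N). real k / real N + u k N / real k
        + 528 * sqrt (real k * (g_fun P \<mu> \<sigma> (real N / real k))\<^sup>2 / l k N)) p < e"
      by (rule order_tendstoD) (use that in simp)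
    moreover have "\<forall>\<^sub>F p in kN_limit. 1 \<le> fst p"
      using lim1(1) by (auto simp: filterlim_at_top)
    moreover have "\<forall>\<^sub>F p in kN_limit. 2 \<le> (\<lambda>(k, N). real N / real k) p"
      using lim1(2) by (auto simp: filterlim_at_top)
    ultimately show ?thesis using l_pos
    proof eventually_elim
      case (elim p)
      obtain k N where p: "p = (k, N)" by (cases p)
      have k: "1 \<le> k" and N: "2 \<le> real N / real k" and l: "0 < l k N"
        using elim by (simp_all add: p)
      have N': "2 * k \<le> N"
      proof -
        have "real (2 * k) \<le> real N" using k N by (simp add: field_simps)
        thus ?thesis by (simp only: of_nat_le_iff)
      qed
      have "\<bar>\<epsilon> k N t\<bar> < e" if t: "t \<in> {l k N..u k N}" for t
      proof -
        have "\<bar>2 * real k * pi * (D k N t)\<^sup>2 / t - 1\<bar> \<le> real k / real N + u k N / real k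
            + 528 * sqrt (real k * (g_fun P \<mu> \<sigma> (real N / real k))\<^sup>2 / l k N)"
          unfolding D_def using t by (intro exponent_deviation assms k N' l) auto
        also have "\<dots> < e" using elim(1) by (simp add: p)
        finally show ?thesis using l t by (auto simp: \<epsilon>_def)
      qed
      thus ?case by (simp add: p)
    qed
  qed
  moreover have "measure M {\<omega> \<in> space M. \<bar>sqrt (real N) * (\<mu>hat \<omega> - \<mu>)\<bar> \<ge> \<sigma> * sqrt t}
      \<le> 2 * exp (- (t / pi) * (1 + \<epsilon> k N t))"
    if k: "1 \<le> k" "real k \<le> real N / 2" and M: "prob_space M" and X: "iid_sample M P N X"
      and G: "random_blocks M k N X G" and mom: "is_MOM M k X G \<mu>hat"
    for k N t and M :: "'w measure" and X :: "nat \<Rightarrow> 'w \<Rightarrow> real" and G \<mu>hat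
  proof -
    interpret prob_space M by (rule M)
    show ?thesis
    proof (cases "0 < t")
      case True
      hence eq: "- (t / pi) * (1 + \<epsilon> k N t) = - 2 * real k * (D k N t)\<^sup>2"
        by (simp add: \<epsilon>_def)
      show ?thesis
        unfolding eq D_def using True by (intro mom_tail[OF assms(3-7) X G mom k]) simp
    next
      \<comment> \<open>For t \<le> 0 the right side with \<epsilon> = 0 is at least 2.\<close>
      case False
      have "prob {\<omega> \<in> space M. \<bar>sqrt (real N) * (\<mu>hat \<omega> - \<mu>)\<bar> \<ge> \<sigma> * sqrt t} \<le> 1"
        by (rule prob_le_1)
      also have "1 \<le> 2 * exp (- (t / pi))"
      proof -
        have "1 \<le> exp (- (t / pi))" using False by (simp add: divide_le_0_iff)
        thus ?thesis by linarith
      qed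
      finally show ?thesis using False by (simp add: \<epsilon>_def)
    qed
  qed
  ultimately show ?thesis by (intro exI[of _ \<epsilon>]) blast
qed

end
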